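(* Let $A,B$ be $n\times n$ Hermitian positive definite matrices. Let $\mathrm{Eig}^{\downarrow}(X)$ denote the diagonal matrix whose diagonal is the vector of eigenvalues of $X$ sorted in decreasing order, and $\mathrm{Eig}^{\uparrow}(X)$ the one whose diagonal is the vector of eigenvalues sorted in increasing order. Then $$\delta_S(\mathrm{Eig}^{\downarrow}(A),\mathrm{Eig}^{\downarrow}(B))\le\delta_S(A,B)\le\delta_S(\mathrm{Eig}^{\downarrow}(A),\mathrm{Eig}^{\uparrow}(B)).$$
   Context: For Hermitian positive definite $X,Y$, $\delta_S(X,Y)$ is the nonnegative square root of $\delta_S^2(X,Y):=\log\det\left(\frac{X+Y}{2}\right)-\frac12\log\det(XY)$. *)

theory Defs
  imports "Jordan_Normal_Form.Schur_Decomposition" "HOL-Library.Multiset"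
begin

(* For a Hermitian matrix the quadratic form is real, so its sign is read off the real part. *)
definition hermitian_pos_def :: "nat \<Rightarrow> complex mat \<Rightarrow> bool" where
  "hermitian_pos_def n A \<longleftrightarrow>
     A \<in> carrier_mat n n \<and> mat_adjoint A = A \<and>
     (\<forall>v \<in> carrier_vec n. v \<noteq> 0\<^sub>v n \<longrightarrow> 0 < Re ((A *\<^sub>v v) \<bullet>c v))"

(* Meaningful for Hermitian positive definite X, Y of the same size: both determinants are
   then positive reals (as complex numbers), so Re only changes their type, and the squared
   value is nonnegative, so sqrt is its nonnegative square root. *)
definition delta_S_sq :: "complex mat \<Rightarrow> complex mat \<Rightarrow> real" where
  "delta_S_sq X Y =
     ln (Re (det ((1 / 2) \<cdot>\<^sub>m (X + Y)))) - 1 / 2 * ln (Re (det (X * Y)))"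

definition delta_S :: "complex mat \<Rightarrow> complex mat \<Rightarrow> real" where
  "delta_S X Y = sqrt (delta_S_sq X Y)"

(* Eigenvalues are listed with algebraic multiplicity, as roots of the characteristic
   polynomial; for Hermitian X they are real, so Re only changes their type. *)
definition eigs_inc :: "complex mat \<Rightarrow> real list" where
  "eigs_inc X = sorted_list_of_multiset (image_mset Re (proots (char_poly X)))"

definition eigs_dec :: "complex mat \<Rightarrow> real list" where
  "eigs_dec X = rev (eigs_inc X)"

definition Eig_up :: "complex mat \<Rightarrow> complex mat" where
  "Eig_up X = mat_diag (dim_row X) (\<lambda>i. complex_of_real (eigs_inc X ! i))"

definition Eig_down :: "complex mat \<Rightarrow> complex mat" where
  "Eig_down X = mat_diag (dim_row X) (\<lambda>i. complex_of_real (eigs_dec X ! i))"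

end

theory Submission
  imports Defs
begin

text \<open>
  All three values of \<open>delta_S\<close> involve the same determinant of the product, so the claim is Fiedler's
  inequality: the determinant of \<open>A + B\<close> lies between the product of the \<open>a\<^sub>i + b\<^sub>i\<close> with both spectra
  decreasing and the one with one spectrum increasing and the other decreasing.

  Lower bound: in an eigenbasis of \<open>C = A + B\<close> the eigenvalues \<open>c\<^sub>i\<close> are sums of the diagonal entries of
  \<open>A\<close> and \<open>B\<close>, and these diagonals are doubly stochastic averages of the spectra. Summation by parts
  against \<open>1 / c\<^sub>i\<close> gives \<open>\<Sum>i. (a\<^sub>i + b\<^sub>i) / c\<^sub>i \<le> n\<close>, and \<open>ln x \<le> x - 1\<close> concludes.

  Upper bound: choose \<open>T\<close> with \<open>T\<^sup>* (A + B) T = 1\<close>, \<open>T\<^sup>* B T = diag w\<close> and \<open>T\<^sup>* A T = diag (1 - w)\<close>, \<open>w\<close> decreasing.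
  If \<open>g\<^sub>k\<close> is the Gram determinant of the first \<open>k\<close> columns of \<open>T\<close>, the \<open>k\<close>-th leading minors satisfy
  \<open>w\<^sub>1 \<cdots> w\<^sub>k \<le> b\<^sub>1 \<cdots> b\<^sub>k g\<^sub>k\<close> (\<open>b\<close> decreasing) and \<open>(1 - w\<^sub>1) \<cdots> (1 - w\<^sub>k) \<ge> a\<^sub>1 \<cdots> a\<^sub>k g\<^sub>k\<close>
  (\<open>a\<close> increasing), with equality for \<open>k = n\<close>. Summation by parts of the logarithms against \<open>w\<close> and
  \<open>1 - w\<close>, together with concavity of \<open>ln\<close>, bounds \<open>\<Sum>i. ln (a\<^sub>i + b\<^sub>i)\<close> below by
  \<open>- ln g\<^sub>n = ln det (A + B)\<close>.
\<close>

section \<open>Adjoints, diagonal matrices and congruence\<close>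

lemma mat_adjoint_dim [simp]:
  "dim_row (mat_adjoint A) = dim_col A" "dim_col (mat_adjoint A) = dim_row A"
  by (simp_all add: mat_adjoint_def)

lemma mat_adjoint_carrier [simp]:
  "A \<in> carrier_mat n m \<Longrightarrow> mat_adjoint A \<in> carrier_mat m n"
  by (rule carrier_matI) auto

lemma mat_adjoint_index [simp]:
  fixes A :: "complex mat"
  assumes "i < dim_col A" "j < dim_row A"
  shows "mat_adjoint A $$ (i, j) = cnj (A $$ (j, i))"
  using assms by (simp add: mat_adjoint_def mat_of_rows_def conjugate_vec_def)

lemma mat_adjoint_adjoint [simp]:
  "mat_adjoint (mat_adjoint A) = (A :: complex mat)"
  by (rule eq_matI) auto

lemma mat_adjoint_mult:
  fixes A B :: "complex mat"
  assumes "A \<in> carrier_mat n m" "B \<in> carrier_mat m l"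
  shows "mat_adjoint (A * B) = mat_adjoint B * mat_adjoint A"
  using assms by (intro eq_matI) (auto simp: scalar_prod_def mult.commute)

lemma mat_adjoint_add:
  fixes A B :: "complex mat"
  assumes "A \<in> carrier_mat n m" "B \<in> carrier_mat n m"
  shows "mat_adjoint (A + B) = mat_adjoint A + mat_adjoint B"
  using assms by (intro eq_matI) auto

lemma mat_adjoint_one [simp]: "mat_adjoint (1\<^sub>m n) = (1\<^sub>m n :: complex mat)"
  by (rule eq_matI) auto

lemma mat_adjoint_diag [simp]:
  "mat_adjoint (mat_diag n f) = mat_diag n (\<lambda>i. cnj (f i))"
  by (rule eq_matI) (auto simp: mat_diag_def)

lemma mat_diag_cong: "(\<And>i. i < n \<Longrightarrow> f i = g i) \<Longrightarrow> mat_diag n f = mat_diag n g"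
  by (rule eq_matI) (auto simp: mat_diag_def)

lemma mat_diag_add: "mat_diag n f + mat_diag n g = mat_diag n (\<lambda>i. f i + g i :: complex)"
  by (rule eq_matI) (auto simp: mat_diag_def)

lemma mat_diag_index [simp]:
  "i < n \<Longrightarrow> j < n \<Longrightarrow> mat_diag n f $$ (i, j) = (if i = j then f j else 0)"
  by (simp add: mat_diag_def)

lemma det_mat_diag: "det (mat_diag n f) = (\<Prod>i<n. f i :: complex)"
proof -
  have "det (mat_diag n f) = prod_list (diag_mat (mat_diag n f))"
    by (rule det_upper_triangular[of _ n]) (auto simp: mat_diag_def)
  also have "\<dots> = (\<Prod>i<n. f i)"
    by (simp add: diag_mat_def prod.list_conv_set_nth mat_diag_def lessThan_atLeast0)
  finally show ?thesis .
qed

lemma det_mat_adjoint: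
  fixes A :: "complex mat"
  assumes "A \<in> carrier_mat n n"
  shows "det (mat_adjoint A) = cnj (det A)"
proof -
  interpret cnj: comm_ring_hom cnj by unfold_locales auto
  have "mat_adjoint A = map_mat cnj (transpose_mat A)"
    using assms by (intro eq_matI) auto
  then have "det (mat_adjoint A) = cnj (det (transpose_mat A))"
    by (simp only: cnj.hom_det)
  then show ?thesis using assms by (simp add: det_transpose)
qed

lemma scalar_prod_mat_adjoint:
  fixes M :: "complex mat"
  assumes "M \<in> carrier_mat n m" "u \<in> carrier_vec n" "v \<in> carrier_vec m"
  shows "(mat_adjoint M *\<^sub>v u) \<bullet>c v = u \<bullet>c (M *\<^sub>v v)"
proof -
  have "(mat_adjoint M *\<^sub>v u) \<bullet>c v = (\<Sum>i<m. \<Sum>j<n. cnj (M $$ (j, i)) * u $ j * cnj (v $ i))"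
    using assms by (simp add: scalar_prod_def lessThan_atLeast0 sum_distrib_right)
  also have "\<dots> = (\<Sum>j<n. \<Sum>i<m. cnj (M $$ (j, i)) * u $ j * cnj (v $ i))"
    by (rule sum.swap)
  also have "\<dots> = u \<bullet>c (M *\<^sub>v v)"
    using assms by (simp add: scalar_prod_def lessThan_atLeast0 sum_distrib_left mult_ac)
  finally show ?thesis .
qed

lemma mat_adjoint_congruence:
  fixes A T :: "complex mat"
  assumes A: "A \<in> carrier_mat n n" and T: "T \<in> carrier_mat n m" and "mat_adjoint A = A"
  shows "mat_adjoint (mat_adjoint T * A * T) = mat_adjoint T * A * T"
proof -
  have T': "mat_adjoint T \<in> carrier_mat m n" using T by simp
  have "mat_adjoint (mat_adjoint T * A * T) = mat_adjoint T * mat_adjoint (mat_adjoint T * A)"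
    by (rule mat_adjoint_mult[of _ m n _ m]) (use A T T' in auto)
  also have "mat_adjoint (mat_adjoint T * A) = A * T"
    using mat_adjoint_mult[OF T' A] assms(3) by simp
  also have "mat_adjoint T * (A * T) = mat_adjoint T * A * T"
    by (rule assoc_mult_mat[symmetric, of _ m n _ n _ m]) (use A T T' in auto)
  finally show ?thesis .
qed

subsection \<open>Unitary diagonalization of Hermitian matrices\<close>

definition unitary_mat :: "nat \<Rightarrow> complex mat \<Rightarrow> bool" where
  "unitary_mat n U \<longleftrightarrow> U \<in> carrier_mat n n \<and> mat_adjoint U * U = 1\<^sub>m n \<and> U * mat_adjoint U = 1\<^sub>m n"

lemma unitary_matI:
  assumes "U \<in> carrier_mat n n" "mat_adjoint U * U = 1\<^sub>m n"
  shows "unitary_mat n U"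
  using assms mat_mult_left_right_inverse[of "mat_adjoint U" n U]
  by (simp add: unitary_mat_def)

lemma unitary_mat_mult:
  assumes "unitary_mat n U" "unitary_mat n V"
  shows "unitary_mat n (U * V)"
proof (rule unitary_matI)
  have c: "U \<in> carrier_mat n n" "V \<in> carrier_mat n n" "mat_adjoint U \<in> carrier_mat n n" "mat_adjoint V \<in> carrier_mat n n"
    using assms by (auto simp: unitary_mat_def)
  show "U * V \<in> carrier_mat n n" using c by simp
  have "mat_adjoint (U * V) * (U * V) = mat_adjoint V * mat_adjoint U * (U * V)"
    using c by (simp add: mat_adjoint_mult)
  also have "\<dots> = mat_adjoint V * (mat_adjoint U * (U * V))"
    by (rule assoc_mult_mat) (use c in auto)
  also have "mat_adjoint U * (U * V) = mat_adjoint U * U * V"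
    by (rule assoc_mult_mat[symmetric]) (use c in auto)
  also have "\<dots> = V" using assms c by (simp add: unitary_mat_def)
  also have "mat_adjoint V * V = 1\<^sub>m n" using assms by (simp add: unitary_mat_def)
  finally show "mat_adjoint (U * V) * (U * V) = 1\<^sub>m n" .
qed

lemma unitary_mat_adjoint: "unitary_mat n U \<Longrightarrow> unitary_mat n (mat_adjoint U)"
  by (auto simp: unitary_mat_def)

lemma congruence_comp:
  fixes A S T :: "complex mat"
  assumes A: "A \<in> carrier_mat n n" and S: "S \<in> carrier_mat n m" and T: "T \<in> carrier_mat m l"
  shows "mat_adjoint (S * T) * A * (S * T) = mat_adjoint T * (mat_adjoint S * A * S) * T"
proof -
  have S': "mat_adjoint S \<in> carrier_mat m n" and T': "mat_adjoint T \<in> carrier_mat l m"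
    using S T by auto
  have "mat_adjoint (S * T) * A * (S * T) = mat_adjoint T * mat_adjoint S * A * (S * T)"
    using S T by (simp only: mat_adjoint_mult)
  also have "\<dots> = mat_adjoint T * mat_adjoint S * A * S * T"
    by (rule assoc_mult_mat[symmetric, of _ l n _ m _ l]) (use A S T S' T' in auto)
  also have "mat_adjoint T * mat_adjoint S * A = mat_adjoint T * (mat_adjoint S * A)"
    by (rule assoc_mult_mat[of _ l m _ n _ n]) (use A S T S' T' in auto)
  also have "mat_adjoint T * (mat_adjoint S * A) * S = mat_adjoint T * (mat_adjoint S * A * S)"
    by (rule assoc_mult_mat[of _ l m _ n _ m]) (use A S T S' T' in auto)
  finally show ?thesis .
qed

lemma adjoint_mult_index:
  fixes M N :: "complex mat"
  assumes "M \<in> carrier_mat n k" "N \<in> carrier_mat n l" "i < k" "j < l"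
  shows "(mat_adjoint M * N) $$ (i, j) = (\<Sum>m<n. cnj (M $$ (m, i)) * N $$ (m, j))"
  using assms by (simp add: scalar_prod_def lessThan_atLeast0)

lemma congruence_carrier:
  fixes A T :: "complex mat"
  assumes "A \<in> carrier_mat n n" "T \<in> carrier_mat n m"
  shows "mat_adjoint T * A * T \<in> carrier_mat m m"
  using assms by (intro mult_carrier_mat[of _ m n] mult_carrier_mat[of _ m n _ n]) auto

lemma congruence_mat_diag_right:
  fixes X :: "complex mat"
  assumes "X \<in> carrier_mat n n"
  shows "mat_adjoint (mat_diag n f) * X * mat_diag n f
           = mat n n (\<lambda>(i, j). cnj (f i) * X $$ (i, j) * f j)"
  using assms by (simp add: mat_diag_mult_left[of _ n n] mat_diag_mult_right[of _ n n])
    (rule eq_matI, auto)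

text \<open>Gram-Schmidt, applied to a basis that starts with \<open>v\<close>, gives a matrix
  \<open>W\<close> with orthogonal columns whose first column is \<open>v\<close>. Dividing each
  column by its norm makes it unitary; this normalization is where the scalar \<open>c\<close> comes
  from.\<close>

lemma unitary_mat_with_first_col:
  fixes v :: "complex vec"
  assumes v: "v \<in> carrier_vec n" and v0: "v \<noteq> 0\<^sub>v n" and n: "0 < n"
  shows "\<exists>W c. unitary_mat n W \<and> col W 0 = c \<cdot>\<^sub>v v"
proof -
  interpret cof_vec_space n "TYPE(complex)" .
  define b where "b = basis_completion v"
  define ws where "ws = gram_schmidt n b"
  define W where "W = mat_of_cols n ws"
  have span_b: "span (set b) = carrier_vec n" and dist_b: "distinct b"
    and indep: "\<not> lin_dep (set b)" and b: "set b \<subseteq> carrier_vec n" and hdb: "hd b = v"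
    and len_b: "length b = n"
    using basis_completion[OF v v0, folded b_def] by auto
  from hdb len_b n obtain vs where bv: "b = v # vs" by (cases b, auto)
  from gram_schmidt_result[OF b dist_b indep refl, folded ws_def]
  have ws: "set ws \<subseteq> carrier_vec n" "corthogonal ws" "length ws = n"
    by (auto simp: len_b)
  have hdws: "hd ws = v" using gram_schmidt_hd[OF v, of vs, folded bv] unfolding ws_def .
  have orth: "corthogonal_mat W" using orthogonal_mat_of_cols ws unfolding W_def .
  have W: "W \<in> carrier_mat n n"
    using ws unfolding W_def using mat_of_cols_carrier(1)[of n ws] by auto
  \<comment> \<open>The squared norms of the columns of \<open>W\<close>. They form the diagonal of
    its Gram matrix, which is zero elsewhere by orthogonality.\<close>
  define d where "d = (\<lambda>i. \<Sum>m<n. (cmod (W $$ (m, i)))\<^sup>2)"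
  have dii: "(mat_adjoint W * W) $$ (i, i) = of_real (d i)" if "i < n" for i
    unfolding adjoint_mult_index[OF W W that that] d_def of_real_sum
    by (intro sum.cong refl) (subst complex_norm_square, simp add: mult.commute)
  have offd: "(mat_adjoint W * W) $$ (i, j) = 0" if "i < n" "j < n" "i \<noteq> j" for i j
    using orth W that by (auto simp: corthogonal_mat_def Let_def diagonal_mat_def)
  have "d i \<noteq> 0" if "i < n" for i
    using orth W that dii[OF that] by (auto simp: corthogonal_mat_def Let_def)
  moreover have "d i \<ge> 0" for i by (auto simp: d_def intro: sum_nonneg)
  ultimately have dpos: "d i > 0" if "i < n" for i using that by (metis less_eq_real_def)
  define D where "D = mat_diag n (\<lambda>i. complex_of_real (1 / sqrt (d i)))"
  have D: "D \<in> carrier_mat n n" by (simp add: D_def)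
  have "mat_adjoint (W * D) * (1\<^sub>m n) * (W * D) = mat_adjoint D * (mat_adjoint W * 1\<^sub>m n * W) * D"
    by (rule congruence_comp[of _ n _ n _ n]) (use W D in auto)
  then have "mat_adjoint (W * D) * (W * D) = mat_adjoint D * (mat_adjoint W * W) * D"
    using W D by simp
  also have "\<dots> = 1\<^sub>m n"
    unfolding D_def congruence_mat_diag_right[OF mult_carrier_mat[OF mat_adjoint_carrier[OF W] W]]
  proof (rule eq_matI)
    fix i j assume "i < dim_row (1\<^sub>m n :: complex mat)" "j < dim_col (1\<^sub>m n :: complex mat)"
    then have ij: "i < n" "j < n" by auto
    show "mat n n (\<lambda>(i, j). cnj (complex_of_real (1 / sqrt (d i))) * (mat_adjoint W * W) $$ (i, j) *
             complex_of_real (1 / sqrt (d j))) $$ (i, j) = (1\<^sub>m n :: complex mat) $$ (i, j)"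
    proof (cases "i = j")
      case True
      have "1 / sqrt (d i) * d i * (1 / sqrt (d i)) = 1"
        using dpos[OF ij(1)] by (simp add: field_simps)
      then have "complex_of_real (1 / sqrt (d i)) * of_real (d i) * of_real (1 / sqrt (d i)) = 1"
        by (metis of_real_1 of_real_mult)
      then show ?thesis using ij True dii[OF ij(1)] by (simp del: of_real_divide index_mult_mat(1))
    next
      case False
      then show ?thesis using ij offd[OF ij] by (simp del: index_mult_mat(1))
    qed
  qed simp_all
  finally have "unitary_mat n (W * D)" using W D by (intro unitary_matI) simp_all
  moreover have "col (W * D) 0 = complex_of_real (1 / sqrt (d 0)) \<cdot>\<^sub>v v"
  proof (rule eq_vecI)
    have "ws ! 0 = v" using hdws ws(3) n by (metis hd_conv_nth length_0_conv less_numeral_extra(3))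
    then have "col W 0 = v" unfolding W_def using ws n v by (simp add: col_mat_of_cols)
    then have *: "W $$ (i, 0) = v $ i" if "i < n" for i using that W n by (auto simp: col_def)
    fix i assume "i < dim_vec (complex_of_real (1 / sqrt (d 0)) \<cdot>\<^sub>v v)"
    then have i: "i < n" using v by simp
    then show "col (W * D) 0 $ i = (complex_of_real (1 / sqrt (d 0)) \<cdot>\<^sub>v v) $ i"
      using W n v unfolding D_def by (simp add: mat_diag_mult_right[of _ n n] *)
  qed (use W v in simp)
  ultimately show ?thesis by blast
qed

text \<open>Deflation by induction on the list of roots. A unitary \<open>W\<close> whose first
  column is an eigenvector for \<open>e\<close> turns \<open>A\<close> into a matrix with blocks
  \<open>e\<close> and \<open>A3\<close>, where \<open>A3\<close> is Hermitian with the remaining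
  roots. The diagonal comes out in the order of the list, so every arrangement of the spectrum can
  be obtained.\<close>

lemma hermitian_unitary_diag:
  fixes A :: "complex mat"
  assumes "A \<in> carrier_mat n n" "mat_adjoint A = A" "char_poly A = (\<Prod>e\<leftarrow>es. [:- e, 1:])"
  shows "\<exists>U. unitary_mat n U \<and> mat_adjoint U * A * U = mat_diag n (\<lambda>i. es ! i)"
  using assms
proof (induction es arbitrary: n A)
  case Nil
  then have n: "n = 0" using degree_monic_char_poly[OF Nil(1)] by simp
  have "unitary_mat n (1\<^sub>m n)" by (rule unitary_matI) simp_all
  moreover have "mat_adjoint (1\<^sub>m n) * A * 1\<^sub>m n = mat_diag n (\<lambda>i. [] ! i)"
    using Nil(1) n by (intro eq_matI) (auto simp: mat_diag_def)
  ultimately show ?case by blast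
next
  case (Cons e es)
  note A = Cons.prems(1)
  define n1 where "n1 = n - 1"
  have mon: "monic (\<Prod>e\<leftarrow>es. [:- e, 1:])" by (rule monic_prod_list, auto)
  have "degree (char_poly A) = Suc (degree (\<Prod>e\<leftarrow>es. [:- e, 1:]))"
    unfolding Cons.prems(3) using mon by (simp only: list.simps(9) prod_list.Cons, subst degree_mult_eq, auto)
  with degree_monic_char_poly[OF A] have n: "n > 0" "n = Suc n1" by (auto simp: n1_def)
  have "eigenvalue A e"
    unfolding eigenvalue_root_char_poly[OF A] Cons.prems(3) by simp
  then obtain v where v: "v \<in> carrier_vec n" "v \<noteq> 0\<^sub>v n" "A *\<^sub>v v = e \<cdot>\<^sub>v v"
    using A by (auto simp: eigenvalue_def eigenvector_def)
  obtain W c where W: "unitary_mat n W" and colW: "col W 0 = c \<cdot>\<^sub>v v"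
    using unitary_mat_with_first_col[OF v(1,2) n(1)] by blast
  have Wc: "W \<in> carrier_mat n n" "mat_adjoint W \<in> carrier_mat n n"
    using W by (auto simp: unitary_mat_def)
  have colWc: "col W 0 \<in> carrier_vec n" using Wc by (intro carrier_vecI) simp
  define A' where "A' = mat_adjoint W * A * W"
  have A': "A' \<in> carrier_mat n n" unfolding A'_def by (rule congruence_carrier[OF A Wc(1)])
  have herm: "mat_adjoint A' = A'"
    unfolding A'_def by (rule mat_adjoint_congruence[OF A Wc(1) Cons.prems(2)])
  have col0: "col A' 0 = e \<cdot>\<^sub>v unit_vec n 0"
  proof -
    have "col A' 0 = (mat_adjoint W * A) *\<^sub>v col W 0"
      unfolding A'_def by (rule col_mult2[of _ n n _ n]) (use A Wc n colWc in auto)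
    also have "\<dots> = mat_adjoint W *\<^sub>v (A *\<^sub>v col W 0)"
      by (rule assoc_mult_mat_vec[of _ n n _ n]) (use A Wc n colWc in auto)
    also have "A *\<^sub>v col W 0 = e \<cdot>\<^sub>v col W 0"
      using A v by (simp add: colW mult_mat_vec[of _ n n] smult_smult_assoc mult.commute)
    also have "mat_adjoint W *\<^sub>v (e \<cdot>\<^sub>v col W 0) = e \<cdot>\<^sub>v (mat_adjoint W *\<^sub>v col W 0)"
      by (rule mult_mat_vec[of _ n n]) (use Wc colWc in auto)
    also have "mat_adjoint W *\<^sub>v col W 0 = col (mat_adjoint W * W) 0"
      by (rule col_mult2[symmetric, of _ n n _ n]) (use Wc n in auto)
    also have "\<dots> = unit_vec n 0" using W n by (simp add: unitary_mat_def)
    finally show ?thesis .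
  qed
  have A'0: "A' $$ (i, 0) = (if i = 0 then e else 0)" if "i < n" for i
    using arg_cong[OF col0, of "\<lambda>v. v $ i"] that A' n by (simp add: unit_vec_def)
  \<comment> \<open>The first row is the conjugate of the first column; the corner entry shows in
    passing that \<open>e\<close> is real.\<close>
  have A'0': "A' $$ (0, i) = (if i = 0 then e else 0)" if "i < n" for i
  proof -
    have "A' $$ (0, i) = cnj (A' $$ (i, 0))"
      using herm that A' n by (metis carrier_matD mat_adjoint_index)
    moreover have "e = cnj e" using herm A'0[of 0] A' n by (metis carrier_matD mat_adjoint_index)
    ultimately show ?thesis using A'0[OF that] by (cases "i = 0") auto
  qed
  define A3 where "A3 = mat n1 n1 (\<lambda>(i, j). A' $$ (Suc i, Suc j))"
  have A3: "A3 \<in> carrier_mat n1 n1" by (simp add: A3_def)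
  define E where "E = mat 1 1 (\<lambda>_. e)"
  have E: "E \<in> carrier_mat 1 1" by (simp add: E_def)
  have block: "A' = four_block_mat E (0\<^sub>m 1 n1) (0\<^sub>m n1 1) A3"
    using A' n by (intro eq_matI) (auto simp: E_def A3_def A'0 A'0')
  \<comment> \<open>As \<open>W\<close> is unitary, the congruence is also a similarity and
    preserves the characteristic polynomial. Cancelling the factor of \<open>e\<close> then leaves
    the one of \<open>A3\<close>.\<close>
  have "similar_mat_wit A' A (mat_adjoint W) W"
    by (rule similar_mat_witI[of _ _ n]) (use W Wc A A' A'_def in \<open>auto simp: unitary_mat_def\<close>)
  then have "char_poly A' = char_poly A"
    by (intro char_poly_similar) (auto simp: similar_mat_def)
  moreover have "char_poly A' = char_poly E * char_poly A3"
    unfolding block by (rule char_poly_four_block_zeros_col[OF E _ A3]) simp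
  moreover have "char_poly E = [:-e, 1:]"
    by (simp add: E_def char_poly_defs det_def sign_def)
  ultimately have "[:- e, 1:] * char_poly A3 = [:- e, 1:] * (\<Prod>e\<leftarrow>es. [:- e, 1:])"
    using Cons.prems(3) by simp
  then have "char_poly A3 = (\<Prod>e\<leftarrow>es. [:- e, 1:])"
    by (subst (asm) mult_cancel_left) simp
  moreover have "mat_adjoint A3 = A3"
  proof (rule eq_matI)
    fix i j assume "i < dim_row A3" "j < dim_col A3"
    then have "Suc i < n" "Suc j < n" "i < n1" "j < n1" using A3 n by auto
    moreover from this have "A' $$ (Suc i, Suc j) = cnj (A' $$ (Suc j, Suc i))"
      using herm A' by (metis carrier_matD mat_adjoint_index)
    ultimately show "mat_adjoint A3 $$ (i, j) = A3 $$ (i, j)" by (simp add: A3_def)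
  qed (simp_all add: A3_def)
  ultimately obtain U where U: "unitary_mat n1 U" "mat_adjoint U * A3 * U = mat_diag n1 (\<lambda>i. es ! i)"
    using Cons.IH[OF A3] by blast
  have Uc: "U \<in> carrier_mat n1 n1" "mat_adjoint U \<in> carrier_mat n1 n1"
    using U by (auto simp: unitary_mat_def)
  \<comment> \<open>The unitary that diagonalizes \<open>A3\<close>, bordered so that it fixes the
    first coordinate.\<close>
  define X where "X = four_block_mat (1\<^sub>m 1) (0\<^sub>m 1 n1) (0\<^sub>m n1 1) U"
  have X: "X \<in> carrier_mat n n" using Uc n unfolding X_def by (intro carrier_matI) simp_all
  have aX: "mat_adjoint X = four_block_mat (1\<^sub>m 1) (0\<^sub>m 1 n1) (0\<^sub>m n1 1) (mat_adjoint U)"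
    using Uc n by (intro eq_matI) (auto simp: X_def)
  have "mat_adjoint X * X = four_block_mat (1\<^sub>m 1) (0\<^sub>m 1 n1) (0\<^sub>m n1 1) (mat_adjoint U * U)"
    unfolding aX unfolding X_def
    using Uc mult_carrier_mat[OF Uc(2) Uc(1)] by (subst mult_four_block_mat[of _ 1 1 _ n1 _ n1 _ _ 1 _ n1]) simp_all
  also have "mat_adjoint U * U = 1\<^sub>m n1" using U by (simp add: unitary_mat_def)
  also have "four_block_mat (1\<^sub>m 1) (0\<^sub>m 1 n1) (0\<^sub>m n1 1) (1\<^sub>m n1) = (1\<^sub>m n :: complex mat)"
    using n by (intro eq_matI) auto
  finally have uX: "unitary_mat n X" using X by (intro unitary_matI)
  have "mat_adjoint (W * X) * A * (W * X) = mat_adjoint X * A' * X"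
    unfolding A'_def by (rule congruence_comp[OF A Wc(1) X])
  also have "mat_adjoint X * A' = four_block_mat E (0\<^sub>m 1 n1) (0\<^sub>m n1 1) (mat_adjoint U * A3)"
    unfolding aX block
    using Uc E A3 mult_carrier_mat[OF Uc(2) A3] congruence_carrier[OF A3 Uc(1)] by (subst mult_four_block_mat[of _ 1 1 _ n1 _ n1 _ _ 1 _ n1]) simp_all
  also have "\<dots> * X = four_block_mat E (0\<^sub>m 1 n1) (0\<^sub>m n1 1) (mat_adjoint U * A3 * U)"
    unfolding X_def
    using Uc E A3 mult_carrier_mat[OF Uc(2) A3] congruence_carrier[OF A3 Uc(1)] by (subst mult_four_block_mat[of _ 1 1 _ n1 _ n1 _ _ 1 _ n1]) simp_all
  also have "\<dots> = mat_diag n (\<lambda>i. (e # es) ! i)"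
    unfolding U(2) using n by (intro eq_matI) (auto simp: E_def nth_Cons' mat_diag_def)
  finally show ?case using unitary_mat_mult[OF W uX] by blast
qed

lemma unitary_congruence_inverse:
  fixes A :: "complex mat"
  assumes U: "unitary_mat n U" and A: "A \<in> carrier_mat n n" and D: "mat_adjoint U * A * U = D"
  shows "A = mat_adjoint (mat_adjoint U) * D * mat_adjoint U"
proof -
  have c: "U \<in> carrier_mat n n" "mat_adjoint U \<in> carrier_mat n n" using U by (auto simp: unitary_mat_def)
  have "mat_adjoint (U * mat_adjoint U) * A * (U * mat_adjoint U)
      = mat_adjoint (mat_adjoint U) * (mat_adjoint U * A * U) * mat_adjoint U"
    by (rule congruence_comp[OF A c])
  then show ?thesis using U A D by (simp add: unitary_mat_def)
qed

lemma det_congruence: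
  fixes A T :: "complex mat"
  assumes "A \<in> carrier_mat n n" "T \<in> carrier_mat n n"
  shows "det (mat_adjoint T * A * T) = of_real ((cmod (det T))\<^sup>2) * det A"
proof -
  have "det (mat_adjoint T * A * T) = cnj (det T) * det A * det T"
    using assms det_mult[OF mult_carrier_mat[OF mat_adjoint_carrier[OF assms(2)] assms(1)] assms(2)]
      det_mult[OF mat_adjoint_carrier[OF assms(2)] assms(1)] by (simp add: det_mat_adjoint)
  then show ?thesis by (simp only: complex_norm_square mult_ac)
qed

section \<open>Sorted eigenvalue lists of Hermitian matrices\<close>

text \<open>After unitary diagonalization the matrix is diagonal and still Hermitian, so all roots
  of the characteristic polynomial are real. Hence \<open>Re\<close> in \<open>eigs_inc\<close>
  loses nothing, and the sorted list is a rearrangement of the roots with multiplicity.\<close>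

lemma hermitian_real_eigs:
  fixes A :: "complex mat"
  assumes A: "A \<in> carrier_mat n n" and herm: "mat_adjoint A = A"
  shows "length (eigs_inc A) = n"
    and "char_poly A = (\<Prod>e\<leftarrow>map complex_of_real (eigs_inc A). [:- e, 1:])"
proof -
  obtain as where as: "char_poly A = (\<Prod>e\<leftarrow>as. [:- e, 1:])" "length as = n"
    using char_poly_factorized[OF A] by blast
  obtain U where U: "unitary_mat n U" "mat_adjoint U * A * U = mat_diag n (\<lambda>i. as ! i)"
    using hermitian_unitary_diag[OF A herm as(1)] by blast
  have "mat_adjoint (mat_adjoint U * A * U) = mat_adjoint U * A * U"
    using U by (intro mat_adjoint_congruence[OF A _ herm]) (auto simp: unitary_mat_def)
  then have eq: "mat_diag n (\<lambda>i. cnj (as ! i)) = mat_diag n (\<lambda>i. as ! i)" by (simp add: U(2))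
  have "cnj (as ! i) = as ! i" if "i < n" for i
    using arg_cong[OF eq, of "\<lambda>M. M $$ (i, i)"] that by simp
  then have "map (complex_of_real \<circ> Re) as = as"
    using as(2) by (intro map_idI) (metis comp_apply in_set_conv_nth Reals_cnj_iff of_real_Re)
  then have real: "mset (map complex_of_real (map Re as)) = mset as" by (simp only: map_map)
  have "proots (char_poly A) = mset as"
  proof -
    have "proots (\<Prod>e\<leftarrow>as. [:- e, 1:]) = mset as" for as :: "complex list"
    proof (induction as)
      case (Cons a as)
      have "(\<Prod>e\<leftarrow>as. [:- e, 1:]) \<noteq> 0" by (auto simp: prod_list_zero_iff)
      then show ?case using Cons by (simp only: list.simps(9) prod_list.Cons, subst proots_mult) auto
    qed simp
    then show ?thesis by (simp add: as(1))
  qed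
  then have inc: "eigs_inc A = sort (map Re as)"
    unfolding eigs_inc_def by (metis mset_map sorted_list_of_multiset_mset)
  show "length (eigs_inc A) = n" by (simp add: inc as(2))
  have "mset (map complex_of_real (eigs_inc A)) = mset as"
    using real by (simp only: inc mset_map mset_sort)
  then have "image_mset (\<lambda>e. [:- e, 1:]) (mset (map complex_of_real (eigs_inc A))) = image_mset (\<lambda>e. [:- e, 1:]) (mset as)"
    by (rule arg_cong)
  then have "mset (map (\<lambda>e. [:- e, 1:]) (map complex_of_real (eigs_inc A))) = mset (map (\<lambda>e. [:- e, 1:]) as)"
    by (simp only: mset_map)
  then show "char_poly A = (\<Prod>e\<leftarrow>map complex_of_real (eigs_inc A). [:- e, 1:])"
    unfolding as(1) by (metis prod_mset_prod_list)
qed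

text \<open>The product of linear factors ignores the order of its roots, so \<open>es\<close> may
  be any arrangement of the spectrum. Both the increasing and the decreasing one are used.\<close>

lemma hermitian_unitary_diag_eigs:
  fixes A :: "complex mat"
  assumes A: "A \<in> carrier_mat n n" and herm: "mat_adjoint A = A"
    and es: "mset es = mset (eigs_inc A)"
  obtains U where "unitary_mat n U" "mat_adjoint U * A * U = mat_diag n (\<lambda>i. complex_of_real (es ! i))"
proof -
  have "mset (map (\<lambda>e. [:- e, 1:]) (map complex_of_real es))
      = mset (map (\<lambda>e. [:- e, 1:]) (map complex_of_real (eigs_inc A)))"
    by (simp only: mset_map es)
  then have "char_poly A = (\<Prod>e\<leftarrow>map complex_of_real es. [:- e, 1:])"
    unfolding hermitian_real_eigs(2)[OF A herm] by (metis prod_mset_prod_list)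
  then obtain U where U: "unitary_mat n U" "mat_adjoint U * A * U = mat_diag n (\<lambda>i. map complex_of_real es ! i)"
    using hermitian_unitary_diag[OF A herm] by blast
  have "length es = n"
    using hermitian_real_eigs(1)[OF A herm] es by (metis size_mset)
  then have "mat_diag n (\<lambda>i. map complex_of_real es ! i) = mat_diag n (\<lambda>i. complex_of_real (es ! i))"
    by (intro mat_diag_cong) simp
  then show ?thesis using U that by simp
qed

lemma eigs_inc_mono:
  assumes "A \<in> carrier_mat n n" "mat_adjoint A = A" "i \<le> j" "j < n"
  shows "eigs_inc A ! i \<le> eigs_inc A ! j"
  using assms hermitian_real_eigs(1)[OF assms(1,2)]
  by (intro sorted_nth_mono) (simp_all add: eigs_inc_def)

lemma eigs_dec_nth:
  assumes "A \<in> carrier_mat n n" "mat_adjoint A = A" "i < n"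
  shows "eigs_dec A ! i = eigs_inc A ! (n - Suc i)"
  using assms hermitian_real_eigs(1)[OF assms(1,2)] by (simp add: eigs_dec_def rev_nth)

lemma eigs_dec_antimono:
  assumes "A \<in> carrier_mat n n" "mat_adjoint A = A" "i \<le> j" "j < n"
  shows "eigs_dec A ! j \<le> eigs_dec A ! i"
  using assms by (simp add: eigs_dec_nth[of A n] eigs_inc_mono[of A n])

subsection \<open>Hermitian positive definite matrices\<close>

lemma hermitian_pos_defD:
  assumes "hermitian_pos_def n A"
  shows "A \<in> carrier_mat n n" "mat_adjoint A = A"
  using assms by (auto simp: hermitian_pos_def_def)

lemma hermitian_pos_def_add:
  assumes A: "hermitian_pos_def n A" and B: "hermitian_pos_def n B"
  shows "hermitian_pos_def n (A + B)"
  unfolding hermitian_pos_def_def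
proof (intro conjI ballI impI)
  note c = hermitian_pos_defD[OF A] hermitian_pos_defD[OF B]
  show "A + B \<in> carrier_mat n n" using c by simp
  show "mat_adjoint (A + B) = A + B" using c by (simp add: mat_adjoint_add[of _ n n])
  fix v :: "complex vec" assume v: "v \<in> carrier_vec n" "v \<noteq> 0\<^sub>v n"
  have "((A + B) *\<^sub>v v) \<bullet>c v = (A *\<^sub>v v) \<bullet>c v + (B *\<^sub>v v) \<bullet>c v"
    using c v by (simp add: add_mult_distrib_mat_vec[of _ n n] add_scalar_prod_distrib[of _ n])
  then show "0 < Re (((A + B) *\<^sub>v v) \<bullet>c v)"
    using A B v by (simp add: hermitian_pos_def_def add_pos_pos)
qed

text \<open>The left inverse \<open>L\<close> makes \<open>T\<close> injective, and the quadratic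
  form of the new matrix at \<open>v\<close> is that of \<open>A\<close> at the nonzero vector
  \<open>T v\<close>. \<open>T\<close> may be rectangular, which allows passing to leading
  blocks.\<close>

lemma hermitian_pos_def_congruence:
  assumes A: "hermitian_pos_def n A" and T: "T \<in> carrier_mat n m"
    and L: "L \<in> carrier_mat m n" "L * T = 1\<^sub>m m"
  shows "hermitian_pos_def m (mat_adjoint T * A * T)"
  unfolding hermitian_pos_def_def
proof (intro conjI ballI impI)
  note c = hermitian_pos_defD[OF A]
  show "mat_adjoint T * A * T \<in> carrier_mat m m" by (rule congruence_carrier[OF c(1) T])
  show "mat_adjoint (mat_adjoint T * A * T) = mat_adjoint T * A * T"
    by (rule mat_adjoint_congruence[OF c(1) T c(2)])
  fix v :: "complex vec" assume v: "v \<in> carrier_vec m" "v \<noteq> 0\<^sub>v m"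
  have Tv: "T *\<^sub>v v \<in> carrier_vec n" using T v by simp
  have "L *\<^sub>v (T *\<^sub>v v) = v" using L T v by (simp add: assoc_mult_mat_vec[symmetric, of _ m n _ m])
  moreover have "L *\<^sub>v 0\<^sub>v n = 0\<^sub>v m" using L by (intro eq_vecI) (auto simp: scalar_prod_def)
  ultimately have "T *\<^sub>v v \<noteq> 0\<^sub>v n" using v by metis
  then have "0 < Re ((A *\<^sub>v (T *\<^sub>v v)) \<bullet>c (T *\<^sub>v v))"
    using A Tv by (simp add: hermitian_pos_def_def)
  also have "(A *\<^sub>v (T *\<^sub>v v)) \<bullet>c (T *\<^sub>v v) = (mat_adjoint T *\<^sub>v (A *\<^sub>v (T *\<^sub>v v))) \<bullet>c v"
    by (rule scalar_prod_mat_adjoint[symmetric, OF T]) (use c v Tv in auto)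
  also have "mat_adjoint T *\<^sub>v (A *\<^sub>v (T *\<^sub>v v)) = mat_adjoint T * A *\<^sub>v (T *\<^sub>v v)"
    by (rule assoc_mult_mat_vec[symmetric, of _ m n _ n]) (use c T Tv in auto)
  also have "\<dots> = mat_adjoint T * A * T *\<^sub>v v"
    by (rule assoc_mult_mat_vec[symmetric, of _ m n _ m]) (use c T v in auto)
  finally show "0 < Re ((mat_adjoint T * A * T *\<^sub>v v) \<bullet>c v)" .
qed

lemma hermitian_pos_def_diag_pos:
  assumes A: "hermitian_pos_def n A" and i: "i < n"
  shows "0 < Re (A $$ (i, i))"
proof -
  have "0 < Re ((A *\<^sub>v unit_vec n i) \<bullet>c unit_vec n i)"
    using A i by (auto simp: hermitian_pos_def_def dest!: bspec[of _ _ "unit_vec n i"])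
  also have "(A *\<^sub>v unit_vec n i) \<bullet>c unit_vec n i = A $$ (i, i)"
    using hermitian_pos_defD[OF A] i by (simp add: scalar_prod_def unit_vec_def if_distrib if_distribR sum.delta cong: if_cong)
  finally show ?thesis .
qed

lemma hermitian_pos_def_mat_diag:
  assumes "\<And>i. i < n \<Longrightarrow> 0 < b i"
  shows "hermitian_pos_def n (mat_diag n (\<lambda>i. complex_of_real (b i)))"
  unfolding hermitian_pos_def_def
proof (intro conjI ballI impI)
  fix v :: "complex vec" assume v: "v \<in> carrier_vec n" "v \<noteq> 0\<^sub>v n"
  obtain k where k: "k < n" "v $ k \<noteq> 0"
    using v by (metis eq_vecI carrier_vecD index_zero_vec)
  have "(mat_diag n (\<lambda>i. complex_of_real (b i)) *\<^sub>v v) $ i = of_real (b i) * v $ i" if "i < n" for i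
    using v that by (simp add: scalar_prod_def mat_diag_def if_distrib[of "\<lambda>z. z * _"] cong: if_cong)
  then have "(mat_diag n (\<lambda>i. complex_of_real (b i)) *\<^sub>v v) \<bullet>c v
      = (\<Sum>i<n. of_real (b i) * v $ i * cnj (v $ i))"
    using v by (subst scalar_prod_def) (simp add: lessThan_atLeast0 del: index_mult_mat_vec)
  also have "\<dots> = of_real (\<Sum>i<n. b i * (cmod (v $ i))\<^sup>2)"
    unfolding of_real_sum of_real_mult by (intro sum.cong refl) (simp only: complex_norm_square mult.assoc)
  finally have "Re ((mat_diag n (\<lambda>i. complex_of_real (b i)) *\<^sub>v v) \<bullet>c v) = (\<Sum>i<n. b i * (cmod (v $ i))\<^sup>2)"
    by simp
  also have "\<dots> > 0"
    using k assms by (intro sum_pos2[of _ k]) (auto simp: less_imp_le)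
  finally show "0 < Re ((mat_diag n (\<lambda>i. complex_of_real (b i)) *\<^sub>v v) \<bullet>c v)" .
qed simp_all

lemma eigs_inc_pos:
  assumes A: "hermitian_pos_def n A" and i: "i < n"
  shows "0 < eigs_inc A ! i"
proof -
  note c = hermitian_pos_defD[OF A]
  obtain U where U: "unitary_mat n U" "mat_adjoint U * A * U = mat_diag n (\<lambda>i. complex_of_real (eigs_inc A ! i))"
    using hermitian_unitary_diag_eigs[OF c refl] .
  have "hermitian_pos_def n (mat_adjoint U * A * U)"
    by (rule hermitian_pos_def_congruence[OF A, of _ _ "mat_adjoint U"]) (use U in \<open>auto simp: unitary_mat_def\<close>)
  then show ?thesis using hermitian_pos_def_diag_pos[OF _ i] U i by fastforce
qed

lemma eigs_dec_pos:
  assumes "hermitian_pos_def n A" "i < n"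
  shows "0 < eigs_dec A ! i"
  using assms hermitian_pos_defD[OF assms(1)] by (simp add: eigs_dec_nth[of A n] eigs_inc_pos)

text \<open>An eigenbasis of \<open>X\<close> with columns scaled by \<open>1 / sqrt (x i)\<close>
  turns \<open>X\<close> into the identity. A further unitary \<open>V\<close> that diagonalizes the
  transformed \<open>R\<close> leaves the identity fixed, and listing the eigenvalues in decreasing
  order sorts \<open>r\<close>.\<close>

lemma simultaneous_congruence_diag:
  fixes X R :: "complex mat"
  assumes X: "hermitian_pos_def n X" and R: "R \<in> carrier_mat n n" "mat_adjoint R = R"
  obtains T r where "T \<in> carrier_mat n n" "mat_adjoint T * X * T = 1\<^sub>m n"
    "mat_adjoint T * R * T = mat_diag n (\<lambda>i. complex_of_real (r i))"
    "\<And>i j. i \<le> j \<Longrightarrow> j < n \<Longrightarrow> r j \<le> r i"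
proof -
  note c = hermitian_pos_defD[OF X]
  define x where "x = (\<lambda>i. eigs_inc X ! i)"
  obtain Q where Q: "unitary_mat n Q" "mat_adjoint Q * X * Q = mat_diag n (\<lambda>i. complex_of_real (x i))"
    using hermitian_unitary_diag_eigs[OF c refl] unfolding x_def .
  have x: "x i > 0" if "i < n" for i using eigs_inc_pos[OF X that] by (simp add: x_def)
  have Qc: "Q \<in> carrier_mat n n" using Q by (simp add: unitary_mat_def)
  define D where "D = mat_diag n (\<lambda>i. complex_of_real (1 / sqrt (x i)))"
  have D: "D \<in> carrier_mat n n" by (simp add: D_def)
  define T where "T = Q * D"
  have T: "T \<in> carrier_mat n n" using Qc D by (simp add: T_def)
  have "mat_adjoint T * X * T = mat_adjoint D * (mat_adjoint Q * X * Q) * D"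
    unfolding T_def by (rule congruence_comp[OF c(1) Qc D])
  also have "\<dots> = mat_diag n (\<lambda>i. complex_of_real (1 / sqrt (x i) * x i * (1 / sqrt (x i))))"
    unfolding Q(2) D_def by (simp only: mat_adjoint_diag mat_diag_diag complex_cnj_complex_of_real of_real_mult)
  also have "\<dots> = mat_diag n (\<lambda>i. 1)"
  proof (rule mat_diag_cong)
    fix i assume "i < n"
    then have "1 / sqrt (x i) * x i * (1 / sqrt (x i)) = 1" using x[of i] by (simp add: field_simps)
    then show "complex_of_real (1 / sqrt (x i) * x i * (1 / sqrt (x i))) = 1" by (metis of_real_1)
  qed
  finally have TX: "mat_adjoint T * X * T = 1\<^sub>m n" by simp
  define R' where "R' = mat_adjoint T * R * T"
  have R': "R' \<in> carrier_mat n n" "mat_adjoint R' = R'"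
    using congruence_carrier[OF R(1) T] mat_adjoint_congruence[OF R(1) T R(2)] by (simp_all add: R'_def)
  obtain V where V: "unitary_mat n V" "mat_adjoint V * R' * V = mat_diag n (\<lambda>i. complex_of_real (eigs_dec R' ! i))"
    using hermitian_unitary_diag_eigs[OF R', of "eigs_dec R'"] by (auto simp: eigs_dec_def)
  have Vc: "V \<in> carrier_mat n n" "mat_adjoint V \<in> carrier_mat n n" using V by (auto simp: unitary_mat_def)
  show ?thesis
  proof (rule that)
    show "T * V \<in> carrier_mat n n" using T Vc by simp
    show "mat_adjoint (T * V) * X * (T * V) = 1\<^sub>m n"
      using congruence_comp[OF c(1) T Vc(1)] TX V Vc by (simp add: unitary_mat_def)
    show "mat_adjoint (T * V) * R * (T * V) = mat_diag n (\<lambda>i. complex_of_real (eigs_dec R' ! i))"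
      using congruence_comp[OF R(1) T Vc(1)] V by (simp add: R'_def)
    show "eigs_dec R' ! j \<le> eigs_dec R' ! i" if "i \<le> j" "j < n" for i j
      by (rule eigs_dec_antimono[OF R' that])
  qed
qed

text \<open>A congruence of \<open>X\<close> to the identity gives
  \<open>|det T|^2 det X = 1\<close>.\<close>

lemma hermitian_pos_def_det:
  assumes X: "hermitian_pos_def n X"
  shows "0 < Re (det X)" "det X = of_real (Re (det X))"
proof -
  note c = hermitian_pos_defD[OF X]
  obtain T where T: "T \<in> carrier_mat n n" "mat_adjoint T * X * T = 1\<^sub>m n"
    using simultaneous_congruence_diag[OF X c] .
  have 1: "of_real ((cmod (det T))\<^sup>2) * det X = 1"
    using det_congruence[OF c(1) T(1)] T(2) by simp
  then have "det T \<noteq> 0" by auto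
  then have 2: "det X = of_real (1 / (cmod (det T))\<^sup>2)" "1 / (cmod (det T))\<^sup>2 > 0"
    using 1 by (simp_all add: field_simps)
  then show "0 < Re (det X)" "det X = of_real (Re (det X))" by (metis Re_complex_of_real)+
qed

subsection \<open>Weighted Gram determinants\<close>

text \<open>The Gram matrix of the columns of \<open>S\<close> for the inner product with coordinate
  weights \<open>b\<close>. If \<open>A\<close> is \<open>weighted_gram n V a\<close> with
  \<open>V\<close> unitary, its congruence by \<open>T\<close> is
  \<open>weighted_gram n (V * T) a\<close>, so the spectrum of \<open>A\<close> enters only through
  weights that can be varied.\<close>

definition weighted_gram :: "nat \<Rightarrow> complex mat \<Rightarrow> (nat \<Rightarrow> real) \<Rightarrow> complex mat" where
  "weighted_gram n S b = mat_adjoint S * mat_diag n (\<lambda>i. complex_of_real (b i)) * S"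

lemma weighted_gram_carrier:
  "S \<in> carrier_mat n k \<Longrightarrow> weighted_gram n S b \<in> carrier_mat k k"
  unfolding weighted_gram_def by (rule congruence_carrier[of _ n]) simp_all

lemma weighted_gram_index:
  assumes S: "S \<in> carrier_mat n k" and "l < k" "m < k"
  shows "weighted_gram n S b $$ (l, m) = (\<Sum>i<n. of_real (b i) * (cnj (S $$ (i, l)) * S $$ (i, m)))"
proof -
  have "weighted_gram n S b = mat_adjoint S * (mat_diag n (\<lambda>i. complex_of_real (b i)) * S)"
    unfolding weighted_gram_def by (rule assoc_mult_mat[of _ k n _ n _ k]) (use S in auto)
  also have "\<dots> = mat_adjoint S * mat n k (\<lambda>(i, j). of_real (b i) * S $$ (i, j))"
    using S by (simp add: mat_diag_mult_left[of _ n k])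
  also have "\<dots> $$ (l, m) = (\<Sum>i<n. of_real (b i) * (cnj (S $$ (i, l)) * S $$ (i, m)))"
    using assms by (subst adjoint_mult_index[of _ n k _ k]) (auto intro!: sum.cong)
  finally show ?thesis .
qed

lemma weighted_gram_cong:
  assumes "\<And>i. i < n \<Longrightarrow> b i = c i"
  shows "weighted_gram n S b = weighted_gram n S c"
  unfolding weighted_gram_def using assms by (simp cong: mat_diag_cong)

lemma weighted_gram_mult:
  assumes "S \<in> carrier_mat n k" "T \<in> carrier_mat k l"
  shows "weighted_gram n (S * T) b = mat_adjoint T * weighted_gram n S b * T"
  unfolding weighted_gram_def by (rule congruence_comp[of _ n]) (use assms in simp_all)

lemma hermitian_pos_def_weighted_gram:
  assumes "S \<in> carrier_mat n k" "L \<in> carrier_mat k n" "L * S = 1\<^sub>m k" "\<And>i. i < n \<Longrightarrow> 0 < b i"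
  shows "hermitian_pos_def k (weighted_gram n S b)"
  unfolding weighted_gram_def
  by (rule hermitian_pos_def_congruence[OF hermitian_pos_def_mat_diag]) (use assms in auto)

text \<open>Multiplying one weight by \<open>c\<close> adds \<open>(c - 1) * b j\<close> times a
  rank-one matrix to the Gram matrix. After a congruence taking the original Gram matrix to the
  identity, the new one is diagonal with at most one entry other than 1, and that entry lies between
  1 and \<open>c\<close>.\<close>

lemma det_weighted_gram_scale:
  assumes S: "S \<in> carrier_mat n k" and L: "L \<in> carrier_mat k n" "L * S = 1\<^sub>m k"
    and b: "\<And>i. i < n \<Longrightarrow> 0 < b i" and j: "j < n" and c: "1 \<le> c"
  shows "Re (det (weighted_gram n S b)) \<le> Re (det (weighted_gram n S (b(j := c * b j))))"
    and "Re (det (weighted_gram n S (b(j := c * b j)))) \<le> c * Re (det (weighted_gram n S b))"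
proof -
  define P where "P = weighted_gram n S b"
  define P' where "P' = weighted_gram n S (b(j := c * b j))"
  define R where "R = weighted_gram n S (\<lambda>i. if i = j then 1 else 0)"
  have P: "hermitian_pos_def k P"
    unfolding P_def by (rule hermitian_pos_def_weighted_gram[OF S L b])
  note Pc = hermitian_pos_defD[OF P]
  have P'c: "P' \<in> carrier_mat k k" unfolding P'_def by (rule weighted_gram_carrier[OF S])
  have Rc: "R \<in> carrier_mat k k" unfolding R_def by (rule weighted_gram_carrier[OF S])
  have Rh: "mat_adjoint R = R"
    unfolding R_def weighted_gram_def by (rule mat_adjoint_congruence[of _ n _ k]) (use S in auto)
  \<comment> \<open>\<open>R\<close> has rank one, so at most one of the \<open>r l\<close> is nonzero; it is at most \<open>1 / b j\<close>
    because \<open>P\<close> dominates \<open>b j\<close> times \<open>R\<close>.\<close>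
  obtain T r where T: "T \<in> carrier_mat k k" "mat_adjoint T * P * T = 1\<^sub>m k"
    and r: "mat_adjoint T * R * T = mat_diag k (\<lambda>i. complex_of_real (r i))"
    using simultaneous_congruence_diag[OF P Rc Rh] .
  define M where "M = S * T"
  have M: "M \<in> carrier_mat n k" using S T by (simp add: M_def)
  have PM: "weighted_gram n M b = 1\<^sub>m k"
    using weighted_gram_mult[OF S T(1), of b] T(2) by (simp add: M_def P_def)
  have RM: "weighted_gram n M (\<lambda>i. if i = j then 1 else 0) = mat_diag k (\<lambda>i. complex_of_real (r i))"
    using weighted_gram_mult[OF S T(1)] r by (simp add: M_def R_def)
  have z: "cnj (M $$ (j, l)) * M $$ (j, m) = (if l = m then of_real (r m) else 0)" if "l < k" "m < k" for l m
  proof -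
    have "weighted_gram n M (\<lambda>i. if i = j then 1 else 0) $$ (l, m) = cnj (M $$ (j, l)) * M $$ (j, m)"
      unfolding weighted_gram_index[OF M that] using j
      by (simp add: if_distrib[of complex_of_real] if_distrib[of "\<lambda>z. z * _"] cong: if_cong)
    then show ?thesis unfolding RM using that by simp
  qed
  have rz: "r l = (cmod (M $$ (j, l)))\<^sup>2" if "l < k" for l
    using z[OF that that] complex_norm_square[of "M $$ (j, l)"]
    by (metis (mono_tags) mult.commute of_real_eq_iff)
  have bound: "b j * r l \<le> 1" if "l < k" for l
  proof -
    have "complex_of_real (\<Sum>i<n. b i * (cmod (M $$ (i, l)))\<^sup>2) = weighted_gram n M b $$ (l, l)"
      unfolding weighted_gram_index[OF M that that] of_real_sum of_real_mult complex_norm_square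
      by (simp only: mult.commute)
    also have "\<dots> = 1" unfolding PM using that by simp
    finally have "(\<Sum>i<n. b i * (cmod (M $$ (i, l)))\<^sup>2) = 1" by (metis of_real_eq_1_iff)
    moreover have "b j * (cmod (M $$ (j, l)))\<^sup>2 \<le> (\<Sum>i<n. b i * (cmod (M $$ (i, l)))\<^sup>2)"
      using j b by (intro member_le_sum) (auto simp: less_imp_le)
    ultimately show ?thesis using rz[OF that] by simp
  qed
  \<comment> \<open>The diagonal entries of the scaled Gram matrix after the congruence; their
    product is the ratio of the two determinants.\<close>
  define f where "f = (\<lambda>l. 1 + (c - 1) * (b j * r l))"
  have "mat_adjoint T * P' * T = mat_diag k (\<lambda>l. complex_of_real (f l))"
  proof (rule eq_matI)
    fix l m assume "l < dim_row (mat_diag k (\<lambda>l. complex_of_real (f l)))"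
      "m < dim_col (mat_diag k (\<lambda>l. complex_of_real (f l)))"
    then have lm: "l < k" "m < k" by (auto simp: mat_diag_def)
    have "(mat_adjoint T * P' * T) $$ (l, m) = weighted_gram n M (b(j := c * b j)) $$ (l, m)"
      using weighted_gram_mult[OF S T(1)] by (simp add: M_def P'_def)
    also have "\<dots> = (\<Sum>i<n. of_real (b i) * (cnj (M $$ (i, l)) * M $$ (i, m))
        + (if i = j then of_real ((c - 1) * b j) * (cnj (M $$ (j, l)) * M $$ (j, m)) else 0))"
      unfolding weighted_gram_index[OF M lm] by (intro sum.cong refl) (simp add: algebra_simps)
    also have "\<dots> = weighted_gram n M b $$ (l, m) + of_real ((c - 1) * b j) * (cnj (M $$ (j, l)) * M $$ (j, m))"
      unfolding weighted_gram_index[OF M lm] sum.distrib using j by simp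
    also have "\<dots> = mat_diag k (\<lambda>l. complex_of_real (f l)) $$ (l, m)"
      unfolding PM z[OF lm] using lm by (simp add: f_def)
    finally show "(mat_adjoint T * P' * T) $$ (l, m) = mat_diag k (\<lambda>l. complex_of_real (f l)) $$ (l, m)" .
  qed (use T P'c in \<open>auto simp: mat_diag_def\<close>)
  then have detP': "of_real ((cmod (det T))\<^sup>2) * det P' = of_real (\<Prod>l<k. f l)"
    using det_congruence[OF P'c T(1)] by (simp add: det_mat_diag)
  have detP: "of_real ((cmod (det T))\<^sup>2) * det P = 1"
    using det_congruence[OF Pc(1) T(1)] T(2) by simp
  have gP: "(cmod (det T))\<^sup>2 * Re (det P) = 1" using arg_cong[OF detP, of Re] by simp
  have gP': "(cmod (det T))\<^sup>2 * Re (det P') = (\<Prod>l<k. f l)"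
    using arg_cong[OF detP', of Re] by (simp del: of_real_prod)
  have ratio: "Re (det P') = (\<Prod>l<k. f l) * Re (det P)"
    using gP unfolding gP'[symmetric] by (simp add: mult_ac)
  have f1: "1 \<le> (\<Prod>l<k. f l) \<and> (\<Prod>l<k. f l) \<le> c"
  proof (cases "\<exists>l<k. r l \<noteq> 0")
    case False
    then have "(\<Prod>l<k. f l) = 1" by (intro prod.neutral) (auto simp: f_def)
    then show ?thesis using c by simp
  next
    case True
    then obtain m where m: "m < k" "r m \<noteq> 0" by blast
    \<comment> \<open>Two nonzero \<open>r l\<close>, \<open>r m\<close> would make the off-diagonal
      product of \<open>M $$ (j, l)\<close> and \<open>M $$ (j, m)\<close> nonzero, which
      contradicts diagonality.\<close>
    have "f l = 1" if "l \<in> {..<k} - {m}" for l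
      using z[of l m] that m rz[of l] rz[of m] by (auto simp: f_def)
    then have "(\<Prod>l<k. f l) = f m"
      using m by (subst prod.remove[of _ m]) auto
    moreover have "0 \<le> b j * r m" using rz[OF m(1)] b[OF j] by simp
    moreover have "(c - 1) * (b j * r m) \<le> (c - 1) * 1"
      using bound[OF m(1)] c by (intro mult_left_mono) auto
    ultimately show ?thesis using c by (simp add: f_def)
  qed
  have pos: "0 < Re (det P)" by (rule hermitian_pos_def_det[OF P])
  show "Re (det (weighted_gram n S b)) \<le> Re (det (weighted_gram n S (b(j := c * b j))))"
    using ratio f1 pos unfolding P_def P'_def by (simp add: mult_le_cancel_right1)
  show "Re (det (weighted_gram n S (b(j := c * b j)))) \<le> c * Re (det (weighted_gram n S b))"
    using ratio f1 pos unfolding P_def P'_def by simp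
qed

text \<open>The weights are changed one coordinate at a time: \<open>d m\<close> has the first
  \<open>m\<close> of them replaced, and each step multiplies the determinant by a factor between 1
  and \<open>c m / b m\<close>.\<close>

lemma det_weighted_gram_mono:
  assumes S: "S \<in> carrier_mat n k" and L: "L \<in> carrier_mat k n" "L * S = 1\<^sub>m k"
    and b: "\<And>i. i < n \<Longrightarrow> 0 < b i" and bc: "\<And>i. i < n \<Longrightarrow> b i \<le> c i"
  shows "Re (det (weighted_gram n S b)) \<le> Re (det (weighted_gram n S c))"
    and "Re (det (weighted_gram n S c)) \<le> (\<Prod>i<n. c i / b i) * Re (det (weighted_gram n S b))"
proof -
  define d where "d = (\<lambda>m i. if i < m then c i else b i)"
  have "Re (det (weighted_gram n S b)) \<le> Re (det (weighted_gram n S (d m))) \<and>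
      Re (det (weighted_gram n S (d m))) \<le> (\<Prod>i<m. c i / b i) * Re (det (weighted_gram n S b))"
    if "m \<le> n" for m
    using that
  proof (induction m)
    case 0
    then show ?case by (simp add: d_def)
  next
    case (Suc m)
    then have m: "m < n" by simp
    have q: "1 \<le> c m / b m" using b[OF m] bc[OF m] by simp
    have dpos: "0 < d m i" if "i < n" for i
      using b[OF that] bc[OF that] by (simp add: d_def)
    have "d (Suc m) = (d m)(m := c m / b m * d m m)"
      using b[OF m] by (auto simp: d_def)
    then have *: "Re (det (weighted_gram n S (d m))) \<le> Re (det (weighted_gram n S (d (Suc m))))"
      "Re (det (weighted_gram n S (d (Suc m)))) \<le> c m / b m * Re (det (weighted_gram n S (d m)))"
      using det_weighted_gram_scale[OF S L dpos m q] by simp_all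
    have "c m / b m * Re (det (weighted_gram n S (d m)))
        \<le> c m / b m * ((\<Prod>i<m. c i / b i) * Re (det (weighted_gram n S b)))"
      using Suc q by (intro mult_left_mono) auto
    then show ?case using * Suc by (simp add: mult_ac)
  qed
  from this[of n] show "Re (det (weighted_gram n S b)) \<le> Re (det (weighted_gram n S c))"
    and "Re (det (weighted_gram n S c)) \<le> (\<Prod>i<n. c i / b i) * Re (det (weighted_gram n S b))"
    using weighted_gram_cong[of n "d n" c S] by (simp_all add: d_def)
qed

lemma det_weighted_gram_const:
  assumes S: "S \<in> carrier_mat n k"
  shows "Re (det (weighted_gram n S (\<lambda>_. \<beta>))) = \<beta> ^ k * Re (det (weighted_gram n S (\<lambda>_. 1)))"
proof -
  have "weighted_gram n S (\<lambda>_. \<beta>) = complex_of_real \<beta> \<cdot>\<^sub>m weighted_gram n S (\<lambda>_. 1)"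
    using weighted_gram_carrier[OF S, of "\<lambda>_. \<beta>"] weighted_gram_carrier[OF S, of "\<lambda>_. 1"]
    by (intro eq_matI) (auto simp: weighted_gram_index[OF S] sum_distrib_left)
  then show ?thesis
    using weighted_gram_carrier[OF S, of "\<lambda>_. 1"] by (simp flip: of_real_power)
qed

text \<open>
  Replacing \<open>b\<close> by its maximum (below: minimum) with \<open>b (k - 1)\<close> reduces the bound to constant weights,
  at a cost of a factor \<open>b i / b (k - 1)\<close> for each \<open>i < k\<close> only.
\<close>

lemma det_weighted_gram_le:
  assumes S: "S \<in> carrier_mat n k" and L: "L \<in> carrier_mat k n" "L * S = 1\<^sub>m k"
    and b: "\<And>i. i < n \<Longrightarrow> 0 < b i" and mono: "\<And>i j. i \<le> j \<Longrightarrow> j < n \<Longrightarrow> b j \<le> b i" and k: "k \<le> n"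
  shows "Re (det (weighted_gram n S b)) \<le> (\<Prod>i<k. b i) * Re (det (weighted_gram n S (\<lambda>_. 1)))"
proof (cases "k = 0")
  case True
  then show ?thesis using weighted_gram_carrier[OF S] by simp
next
  case False
  define \<beta> where "\<beta> = b (k - 1)"
  have \<beta>: "\<beta> > 0" using b k False by (simp add: \<beta>_def)
  have pos: "0 < Re (det (weighted_gram n S (\<lambda>_. 1)))"
    by (rule hermitian_pos_def_det(1)[OF hermitian_pos_def_weighted_gram[OF S L]]) simp
  define M where "M = (\<lambda>i. max (b i) \<beta>)"
  have "Re (det (weighted_gram n S b)) \<le> Re (det (weighted_gram n S M))"
    by (rule det_weighted_gram_mono(1)[OF S L b]) (auto simp: M_def)
  also have "\<dots> \<le> (\<Prod>i<n. M i / \<beta>) * Re (det (weighted_gram n S (\<lambda>_. \<beta>)))"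
    by (rule det_weighted_gram_mono(2)[OF S L]) (auto simp: M_def \<beta>)
  \<comment> \<open>Beyond the first \<open>k\<close> indices \<open>b i\<close> is at most
    \<open>\<beta>\<close>, so the maximum is \<open>\<beta>\<close> and the factor is 1. The
    remaining powers of \<open>\<beta>\<close> cancel against the constant-weight
    determinant.\<close>
  also have "(\<Prod>i<n. M i / \<beta>) = (\<Prod>i<k. b i / \<beta>)"
  proof (rule prod.mono_neutral_cong_right)
    show "\<forall>i\<in>{..<n} - {..<k}. M i / \<beta> = 1"
      using \<beta> mono[of "k - 1"] by (auto simp: M_def \<beta>_def max_def)
    show "M i / \<beta> = b i / \<beta>" if "i \<in> {..<k}" for i
      using that mono[of i "k - 1"] k by (auto simp: M_def \<beta>_def)
  qed (use k in auto)
  also have "\<dots> * Re (det (weighted_gram n S (\<lambda>_. \<beta>)))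
      = (\<Prod>i<k. b i) * Re (det (weighted_gram n S (\<lambda>_. 1)))"
    unfolding det_weighted_gram_const[OF S, of \<beta>] using \<beta> by (simp add: prod_dividef)
  finally show ?thesis .
qed

lemma det_weighted_gram_ge:
  assumes S: "S \<in> carrier_mat n k" and L: "L \<in> carrier_mat k n" "L * S = 1\<^sub>m k"
    and b: "\<And>i. i < n \<Longrightarrow> 0 < b i" and mono: "\<And>i j. i \<le> j \<Longrightarrow> j < n \<Longrightarrow> b i \<le> b j" and k: "k \<le> n"
  shows "(\<Prod>i<k. b i) * Re (det (weighted_gram n S (\<lambda>_. 1))) \<le> Re (det (weighted_gram n S b))"
proof (cases "k = 0")
  case True
  then show ?thesis using weighted_gram_carrier[OF S] by simp
next
  case False
  define \<beta> where "\<beta> = b (k - 1)"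
  have \<beta>: "\<beta> > 0" using b k False by (simp add: \<beta>_def)
  define M where "M = (\<lambda>i. min (b i) \<beta>)"
  have Mpos: "M i > 0" if "i < n" for i using b[OF that] \<beta> by (simp add: M_def)
  have bpos: "(\<Prod>i<k. b i / \<beta>) > 0" using b k \<beta> by (intro prod_pos) auto
  have "\<beta> ^ k * Re (det (weighted_gram n S (\<lambda>_. 1))) = Re (det (weighted_gram n S (\<lambda>_. \<beta>)))"
    by (rule det_weighted_gram_const[OF S, symmetric])
  \<comment> \<open>The minimum \<open>M\<close> lies below both the constant \<open>\<beta>\<close>
    and \<open>b\<close>: the ratio bound compares it with \<open>\<beta>\<close> here, plain
    monotonicity compares it with \<open>b\<close> at the end.\<close>
  also have "\<dots> \<le> (\<Prod>i<n. \<beta> / M i) * Re (det (weighted_gram n S M))"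
    by (rule det_weighted_gram_mono(2)[OF S L Mpos]) (auto simp: M_def)
  also have "(\<Prod>i<n. \<beta> / M i) = (\<Prod>i<k. \<beta> / b i)"
  proof (rule prod.mono_neutral_cong_right)
    have "\<beta> \<le> b i" if "k \<le> i" "i < n" for i
      unfolding \<beta>_def using that by (intro mono) auto
    then show "\<forall>i\<in>{..<n} - {..<k}. \<beta> / M i = 1"
      using \<beta> by (auto simp: M_def)
    show "\<beta> / M i = \<beta> / b i" if "i \<in> {..<k}" for i
      using that mono[of i "k - 1"] k by (auto simp: M_def \<beta>_def)
  qed (use k in auto)
  also have "(\<Prod>i<k. \<beta> / b i) = \<beta> ^ k / (\<Prod>i<k. b i)" by (simp add: prod_dividef)
  finally have "\<beta> ^ k * Re (det (weighted_gram n S (\<lambda>_. 1))) \<le> \<beta> ^ k * (Re (det (weighted_gram n S M)) / (\<Prod>i<k. b i))"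
    by simp
  then have "Re (det (weighted_gram n S (\<lambda>_. 1))) \<le> Re (det (weighted_gram n S M)) / (\<Prod>i<k. b i)"
    using \<beta> by (subst (asm) mult_le_cancel_left_pos) auto
  moreover have "(\<Prod>i<k. b i) > 0" using b k by (intro prod_pos) auto
  ultimately have "(\<Prod>i<k. b i) * Re (det (weighted_gram n S (\<lambda>_. 1))) \<le> Re (det (weighted_gram n S M))"
    by (simp add: field_simps)
  also have "\<dots> \<le> Re (det (weighted_gram n S b))"
    by (rule det_weighted_gram_mono(1)[OF S L Mpos]) (auto simp: M_def)
  finally show ?thesis .
qed

subsection \<open>Real inequalities\<close>

lemma ln_prod_lessThan:
  fixes f :: "nat \<Rightarrow> real"
  assumes "\<And>i. i < n \<Longrightarrow> 0 < f i"
  shows "ln (\<Prod>i<n. f i) = (\<Sum>i<n. ln (f i))"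
  by (intro ln_prod finite_lessThan) (metis assms lessThan_iff less_irrefl)

text \<open>Summation by parts in inductive form. The weights themselves may have any sign, because
  the boundary term is multiplied by the total, which is zero.\<close>

lemma sum_antimono_weights_nonneg:
  fixes p y :: "nat \<Rightarrow> real"
  assumes p: "\<And>i j. i \<le> j \<Longrightarrow> j < n \<Longrightarrow> p j \<le> p i"
    and y: "\<And>k. k \<le> n \<Longrightarrow> 0 \<le> (\<Sum>i<k. y i)" and total: "(\<Sum>i<n. y i) = 0"
  shows "0 \<le> (\<Sum>i<n. p i * y i)"
proof -
  \<comment> \<open>For \<open>m = 0\<close> the truncated index \<open>m - 1\<close> is harmless,
    as both sums are empty. In the step \<open>p (m - 1)\<close> may be lowered to
    \<open>p m\<close> because the partial sum is nonnegative.\<close>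
  have "p (m - 1) * (\<Sum>i<m. y i) \<le> (\<Sum>i<m. p i * y i)" if "m \<le> n" for m
    using that
  proof (induction m)
    case (Suc m)
    have "p m * (\<Sum>i<m. y i) \<le> p (m - 1) * (\<Sum>i<m. y i)"
      using Suc.prems y p[of "m - 1" m] by (intro mult_right_mono) auto
    then show ?case using Suc by (simp add: algebra_simps)
  qed simp
  from this[of n] show ?thesis by (simp add: total)
qed

lemma sum_mono_weights_nonpos:
  fixes p y :: "nat \<Rightarrow> real"
  assumes "\<And>i j. i \<le> j \<Longrightarrow> j < n \<Longrightarrow> p i \<le> p j"
    and "\<And>k. k \<le> n \<Longrightarrow> 0 \<le> (\<Sum>i<k. y i)" and "(\<Sum>i<n. y i) = 0"
  shows "(\<Sum>i<n. p i * y i) \<le> 0"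
  using sum_antimono_weights_nonneg[of n "\<lambda>i. - p i" y] assms by (simp add: sum_negf)

text \<open>Summing the first \<open>k\<close> rows puts weights \<open>d j\<close> in
  \<open>[0, 1]\<close> with total \<open>k\<close> on the \<open>x j\<close>, and such a
  combination cannot exceed the sum of the \<open>k\<close> largest. The comparison is with the
  indicator \<open>e\<close> of the first \<open>k\<close> indices.\<close>

lemma doubly_stochastic_partial_sum_le:
  fixes D :: "nat \<Rightarrow> nat \<Rightarrow> real"
  assumes D: "\<And>i j. i < n \<Longrightarrow> j < n \<Longrightarrow> 0 \<le> D i j"
    and rows: "\<And>i. i < n \<Longrightarrow> (\<Sum>j<n. D i j) = 1" and cols: "\<And>j. j < n \<Longrightarrow> (\<Sum>i<n. D i j) = 1"
    and x: "\<And>i j. i \<le> j \<Longrightarrow> j < n \<Longrightarrow> x j \<le> x i" and k: "k \<le> n"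
  shows "(\<Sum>i<k. \<Sum>j<n. D i j * x j) \<le> (\<Sum>j<k. x j)"
proof (cases "k = 0")
  case False
  define \<beta> where "\<beta> = x (k - 1)"
  define d where "d = (\<lambda>j. \<Sum>i<k. D i j)"
  define e where "e = (\<lambda>j. if j < k then 1 else 0 :: real)"
  have sumd: "(\<Sum>j<n. d j) = k"
    unfolding d_def using rows k by (subst sum.swap) simp
  have setk: "{j \<in> {..<n}. j < k} = {..<k}" using k by auto
  have sume: "(\<Sum>j<n. f j * e j) = (\<Sum>j<k. f j)" for f :: "nat \<Rightarrow> real"
    unfolding setk[symmetric] sum.inter_filter[OF finite_lessThan] e_def by (intro sum.cong) auto
  \<comment> \<open>With \<open>\<beta>\<close> the \<open>k\<close>-th largest value, the two
    factors have opposite signs on either side of index \<open>k\<close>. Shifting by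
    \<open>\<beta>\<close> costs nothing in the sum, since \<open>d\<close> and \<open>e\<close>
    have the same total.\<close>
  have "(x j - \<beta>) * (d j - e j) \<le> 0" if j: "j < n" for j
  proof (cases "j < k")
    case True
    have "d j \<le> (\<Sum>i<n. D i j)"
      unfolding d_def using D j k by (intro sum_mono2) auto
    then have "d j \<le> 1" using cols[OF j] by simp
    moreover have "\<beta> \<le> x j" unfolding \<beta>_def using True k by (intro x) auto
    ultimately show ?thesis using True by (intro mult_nonneg_nonpos) (auto simp: e_def)
  next
    case False
    have "0 \<le> d j" unfolding d_def using D j k by (intro sum_nonneg) auto
    moreover have "x j \<le> \<beta>" unfolding \<beta>_def using False j by (intro x) auto
    ultimately show ?thesis using False by (intro mult_nonpos_nonneg) (auto simp: e_def)
  qed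
  then have "(\<Sum>j<n. (x j - \<beta>) * (d j - e j)) \<le> 0" by (intro sum_nonpos) auto
  also have "(\<Sum>j<n. (x j - \<beta>) * (d j - e j))
      = (\<Sum>j<n. d j * x j) - (\<Sum>j<n. x j * e j) - \<beta> * ((\<Sum>j<n. d j) - (\<Sum>j<n. 1 * e j))"
    by (simp add: algebra_simps sum.distrib sum_subtractf sum_distrib_left)
  also have "\<dots> = (\<Sum>j<n. d j * x j) - (\<Sum>j<k. x j)"
    unfolding sume sumd by simp
  also have "(\<Sum>j<n. d j * x j) = (\<Sum>i<k. \<Sum>j<n. D i j * x j)"
    unfolding d_def sum_distrib_right by (rule sum.swap)
  finally show ?thesis by simp
qed simp

text \<open>Concavity of \<open>ln\<close> for
  \<open>a + b = w * (b / w) + (1 - w) * (a / (1 - w))\<close>. It is derived from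
  \<open>ln t \<le> t - 1\<close> at \<open>t = x / (u * (a + b))\<close> for the pairs
  \<open>b, w\<close> and \<open>a, 1 - w\<close>, whose linear remainders cancel.\<close>

lemma ln_add_ge_weighted:
  fixes a b w :: real
  assumes "0 < a" "0 < b" "0 < w" "w < 1"
  shows "w * (ln b - ln w) + (1 - w) * (ln a - ln (1 - w)) \<le> ln (a + b)"
proof -
  have *: "u * (ln x - ln u) \<le> u * ln (a + b) + (x / (a + b) - u)" if "0 < x" "0 < u" for x u :: real
  proof -
    have "ln (x / (u * (a + b))) \<le> x / (u * (a + b)) - 1"
      using that assms by (intro ln_le_minus_one) simp
    then have "u * ln (x / (u * (a + b))) \<le> u * (x / (u * (a + b)) - 1)"
      using that by (intro mult_left_mono) auto
    also have "u * (x / (u * (a + b)) - 1) = x / (a + b) - u"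
      using that by (simp add: right_diff_distrib)
    also have "ln (x / (u * (a + b))) = ln x - ln u - ln (a + b)"
      using that assms by (simp add: ln_div ln_mult)
    finally show ?thesis by (simp add: algebra_simps)
  qed
  have "a / (a + b) + b / (a + b) = 1" using assms by (simp add: add_divide_distrib[symmetric])
  then show ?thesis using *[of b w] *[of a "1 - w"] assms by (simp add: algebra_simps)
qed

subsection \<open>Fiedler's inequalities\<close>

lemma unitary_row_col_sums:
  assumes "unitary_mat n M" "i < n"
  shows "(\<Sum>j<n. (cmod (M $$ (j, i)))\<^sup>2) = 1" "(\<Sum>j<n. (cmod (M $$ (i, j)))\<^sup>2) = 1"
proof -
  have *: "(\<Sum>j<n. (cmod (N $$ (j, i)))\<^sup>2) = 1" if N: "unitary_mat n N" for N
  proof -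
    have "complex_of_real (\<Sum>j<n. (cmod (N $$ (j, i)))\<^sup>2) = (mat_adjoint N * N) $$ (i, i)"
      using N assms(2) unfolding of_real_sum complex_norm_square
      by (subst adjoint_mult_index[of _ n n _ n]) (auto simp: unitary_mat_def mult.commute)
    also have "\<dots> = 1" using N assms(2) by (simp add: unitary_mat_def)
    finally show ?thesis by (metis of_real_eq_1_iff)
  qed
  show "(\<Sum>j<n. (cmod (M $$ (j, i)))\<^sup>2) = 1" by (rule *[OF assms(1)])
  have "(\<Sum>j<n. (cmod (M $$ (i, j)))\<^sup>2) = (\<Sum>j<n. (cmod (mat_adjoint M $$ (j, i)))\<^sup>2)"
    using assms by (intro sum.cong) (auto simp: unitary_mat_def)
  then show "(\<Sum>j<n. (cmod (M $$ (i, j)))\<^sup>2) = 1"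
    using *[OF unitary_mat_adjoint[OF assms(1)]] by simp
qed

text \<open>The diagonalizing congruence is inverted, so \<open>V\<close> is the adjoint of the
  eigenvector matrix.\<close>

lemma hermitian_eq_weighted_gram:
  fixes A :: "complex mat"
  assumes A: "A \<in> carrier_mat n n" and herm: "mat_adjoint A = A"
    and es: "mset es = mset (eigs_inc A)"
  obtains V where "unitary_mat n V" "A = weighted_gram n V (\<lambda>i. es ! i)"
proof -
  obtain U where U: "unitary_mat n U" "mat_adjoint U * A * U = mat_diag n (\<lambda>i. complex_of_real (es ! i))"
    using hermitian_unitary_diag_eigs[OF A herm es] .
  show ?thesis
    by (rule that[OF unitary_mat_adjoint[OF U(1)]])
      (unfold weighted_gram_def, rule unitary_congruence_inverse[OF U(1) A U(2)])
qed

text \<open>Schur's majorization theorem. The diagonal in the basis \<open>Q\<close> is the image of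
  the spectrum under the matrix of squared moduli of a unitary matrix, which is doubly
  stochastic.\<close>

lemma hermitian_diag_majorized:
  fixes A :: "complex mat"
  assumes A: "A \<in> carrier_mat n n" and herm: "mat_adjoint A = A" and Q: "unitary_mat n Q"
  shows "k \<le> n \<Longrightarrow> (\<Sum>i<k. Re ((mat_adjoint Q * A * Q) $$ (i, i))) \<le> (\<Sum>i<k. eigs_dec A ! i)"
    and "(\<Sum>i<n. Re ((mat_adjoint Q * A * Q) $$ (i, i))) = (\<Sum>i<n. eigs_dec A ! i)"
proof -
  obtain V where V: "unitary_mat n V" "A = weighted_gram n V (\<lambda>i. eigs_dec A ! i)"
    by (rule hermitian_eq_weighted_gram[OF A herm, of "eigs_dec A"]) (simp add: eigs_dec_def)
  have c: "V \<in> carrier_mat n n" "Q \<in> carrier_mat n n" using V Q by (auto simp: unitary_mat_def)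
  define M where "M = V * Q"
  have M: "unitary_mat n M" "M \<in> carrier_mat n n"
    using unitary_mat_mult[OF V(1) Q] c by (auto simp: M_def)
  have eq: "mat_adjoint Q * A * Q = weighted_gram n M (\<lambda>i. eigs_dec A ! i)"
    using weighted_gram_mult[OF c] V(2) by (simp add: M_def)
  define D where "D = (\<lambda>i j. (cmod (M $$ (j, i)))\<^sup>2)"
  have diag: "Re ((mat_adjoint Q * A * Q) $$ (i, i)) = (\<Sum>j<n. D i j * eigs_dec A ! j)" if "i < n" for i
  proof -
    have "(mat_adjoint Q * A * Q) $$ (i, i) = complex_of_real (\<Sum>j<n. D i j * eigs_dec A ! j)"
      unfolding eq weighted_gram_index[OF M(2) that that] D_def of_real_sum of_real_mult complex_norm_square
      by (intro sum.cong refl) (simp only: mult_ac)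
    then show ?thesis by simp
  qed
  have rows: "(\<Sum>j<n. D i j) = 1" and cols: "(\<Sum>j<n. D j i) = 1" if "i < n" for i
    using unitary_row_col_sums[OF M(1) that] by (simp_all add: D_def)
  show "(\<Sum>i<k. Re ((mat_adjoint Q * A * Q) $$ (i, i))) \<le> (\<Sum>i<k. eigs_dec A ! i)" if k: "k \<le> n"
  proof -
    have "(\<Sum>i<k. Re ((mat_adjoint Q * A * Q) $$ (i, i))) = (\<Sum>i<k. \<Sum>j<n. D i j * eigs_dec A ! j)"
      using k by (intro sum.cong) (auto simp: diag)
    also have "\<dots> \<le> (\<Sum>i<k. eigs_dec A ! i)"
      by (rule doubly_stochastic_partial_sum_le[OF _ rows cols eigs_dec_antimono[OF A herm] k])
        (simp_all add: D_def)
    finally show ?thesis .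
  qed
  have "(\<Sum>i<n. Re ((mat_adjoint Q * A * Q) $$ (i, i))) = (\<Sum>i<n. \<Sum>j<n. D i j * eigs_dec A ! j)"
    by (intro sum.cong) (auto simp: diag)
  also have "\<dots> = (\<Sum>j<n. (\<Sum>i<n. D i j) * eigs_dec A ! j)"
    unfolding sum_distrib_right by (rule sum.swap)
  also have "\<dots> = (\<Sum>i<n. eigs_dec A ! i)"
    by (intro sum.cong) (auto simp: cols)
  finally show "(\<Sum>i<n. Re ((mat_adjoint Q * A * Q) $$ (i, i))) = (\<Sum>i<n. eigs_dec A ! i)" .
qed

lemma hermitian_det_eq_prod:
  fixes A :: "complex mat"
  assumes A: "A \<in> carrier_mat n n" and herm: "mat_adjoint A = A"
    and es: "mset es = mset (eigs_inc A)"
  shows "det A = of_real (\<Prod>i<n. es ! i)"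
proof -
  obtain V where V: "unitary_mat n V" "A = weighted_gram n V (\<lambda>i. es ! i)"
    by (rule hermitian_eq_weighted_gram[OF A herm es])
  have Vc: "V \<in> carrier_mat n n" using V by (simp add: unitary_mat_def)
  have "of_real ((cmod (det V))\<^sup>2) * det (1\<^sub>m n) = det (mat_adjoint V * 1\<^sub>m n * V)"
    by (rule det_congruence[symmetric]) (use Vc in auto)
  also have "\<dots> = 1" using V Vc by (simp add: unitary_mat_def)
  finally have "complex_of_real ((cmod (det V))\<^sup>2) = 1" by simp
  then show ?thesis
    using det_congruence[of "mat_diag n (\<lambda>i. complex_of_real (es ! i))" n V] V(2) Vc
    by (simp add: weighted_gram_def det_mat_diag)
qed

theorem prod_eigs_dec_le_det_add:
  assumes A: "hermitian_pos_def n A" and B: "hermitian_pos_def n B"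
  shows "(\<Prod>i<n. eigs_dec A ! i + eigs_dec B ! i) \<le> Re (det (A + B))"
proof -
  define C where "C = A + B"
  define a b c where "a = (\<lambda>i. eigs_dec A ! i)" and "b = (\<lambda>i. eigs_dec B ! i)" and "c = (\<lambda>i. eigs_dec C ! i)"
  have C: "hermitian_pos_def n C" unfolding C_def by (rule hermitian_pos_def_add[OF A B])
  note cA = hermitian_pos_defD[OF A] and cB = hermitian_pos_defD[OF B] and cC = hermitian_pos_defD[OF C]
  have pos: "0 < a i" "0 < b i" "0 < c i" if "i < n" for i
    using eigs_dec_pos[OF A that] eigs_dec_pos[OF B that] eigs_dec_pos[OF C that]
    by (simp_all add: a_def b_def c_def)
  obtain Q where Q: "unitary_mat n Q" "mat_adjoint Q * C * Q = mat_diag n (\<lambda>i. complex_of_real (c i))"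
    using hermitian_unitary_diag_eigs[OF cC, of "eigs_dec C"] by (auto simp: eigs_dec_def c_def)
  have Qc: "Q \<in> carrier_mat n n" "mat_adjoint Q \<in> carrier_mat n n" using Q by (auto simp: unitary_mat_def)
  define \<alpha> \<beta> where "\<alpha> = (\<lambda>i. Re ((mat_adjoint Q * A * Q) $$ (i, i)))" and
    "\<beta> = (\<lambda>i. Re ((mat_adjoint Q * B * Q) $$ (i, i)))"
  have split: "mat_adjoint Q * C * Q = mat_adjoint Q * A * Q + mat_adjoint Q * B * Q"
    unfolding C_def
    by (subst mult_add_distrib_mat[OF Qc(2) cA(1) cB(1)],
        rule add_mult_distrib_mat[of _ n n _ _ n]) (use cA cB Qc in auto)
  have sum: "\<alpha> i + \<beta> i = c i" if "i < n" for i
  proof -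
    have "(mat_adjoint Q * A * Q + mat_adjoint Q * B * Q) $$ (i, i)
        = (mat_adjoint Q * A * Q) $$ (i, i) + (mat_adjoint Q * B * Q) $$ (i, i)"
      by (rule index_add_mat) (use congruence_carrier[OF cB(1) Qc(1)] that in auto)
    then have "complex_of_real (c i) = (mat_adjoint Q * A * Q) $$ (i, i) + (mat_adjoint Q * B * Q) $$ (i, i)"
      unfolding split[symmetric] Q(2) using that by simp
    then show ?thesis unfolding \<alpha>_def \<beta>_def by (metis Re_complex_of_real plus_complex.sel(1))
  qed
  have cmono: "1 / c i \<le> 1 / c j" if "i \<le> j" "j < n" for i j
    using pos[of i] pos[of j] eigs_dec_antimono[OF cC that] that by (simp add: c_def frac_le)
  \<comment> \<open>The weights \<open>1 / c i\<close> increase, while by majorization the partial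
    sums of \<open>a i - \<alpha> i\<close> are nonnegative with total zero. The same holds for
    \<open>B\<close>.\<close>
  have "(\<Sum>i<n. 1 / c i * (a i - \<alpha> i)) \<le> 0"
    by (rule sum_mono_weights_nonpos[OF cmono])
      (use hermitian_diag_majorized[OF cA Q(1)] in \<open>simp_all add: a_def \<alpha>_def sum_subtractf\<close>)
  moreover have "(\<Sum>i<n. 1 / c i * (b i - \<beta> i)) \<le> 0"
    by (rule sum_mono_weights_nonpos[OF cmono])
      (use hermitian_diag_majorized[OF cB Q(1)] in \<open>simp_all add: b_def \<beta>_def sum_subtractf\<close>)
  ultimately have "(\<Sum>i<n. 1 / c i * (a i - \<alpha> i) + 1 / c i * (b i - \<beta> i)) \<le> 0"
    by (simp only: sum.distrib)
  also have "(\<Sum>i<n. 1 / c i * (a i - \<alpha> i) + 1 / c i * (b i - \<beta> i)) = (\<Sum>i<n. (a i + b i) / c i - 1)"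
  proof (intro sum.cong refl)
    fix i assume "i \<in> {..<n}"
    then have "(\<alpha> i + \<beta> i) / c i = 1" using sum[of i] pos[of i] by simp
    then show "1 / c i * (a i - \<alpha> i) + 1 / c i * (b i - \<beta> i) = (a i + b i) / c i - 1"
      by (simp add: add_divide_distrib diff_divide_distrib)
  qed
  finally have le0: "(\<Sum>i<n. (a i + b i) / c i - 1) \<le> 0" .
  have "ln (\<Prod>i<n. a i + b i) = (\<Sum>i<n. ln (a i + b i))"
    using pos by (intro ln_prod_lessThan add_pos_pos)
  \<comment> \<open>The tangent bound for \<open>ln\<close> at 1, applied to each ratio
    \<open>(a i + b i) / c i\<close>; the linear terms add up to at most zero.\<close>
  also have "\<dots> \<le> (\<Sum>i<n. ln (c i) + ((a i + b i) / c i - 1))"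
  proof (rule sum_mono)
    fix i assume "i \<in> {..<n}"
    then have p: "0 < a i + b i" "0 < c i" using pos[of i] by auto
    then have "ln ((a i + b i) / c i) \<le> (a i + b i) / c i - 1" by (intro ln_le_minus_one) simp
    then show "ln (a i + b i) \<le> ln (c i) + ((a i + b i) / c i - 1)"
      using p by (simp add: ln_div)
  qed
  also have "\<dots> \<le> (\<Sum>i<n. ln (c i))" using le0 by (simp only: sum.distrib)
  also have "\<dots> = ln (\<Prod>i<n. c i)" using pos by (intro ln_prod_lessThan[symmetric])
  finally have "(\<Prod>i<n. a i + b i) \<le> (\<Prod>i<n. c i)"
    using pos by (subst (asm) ln_le_cancel_iff) (auto intro!: prod_pos add_pos_pos)
  moreover have "det C = of_real (\<Prod>i<n. c i)"
    unfolding c_def by (rule hermitian_det_eq_prod[OF cC]) (simp add: eigs_dec_def)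
  ultimately show ?thesis by (simp add: a_def b_def C_def del: of_real_prod)
qed

section \<open>Upper bound: leading minors and summation by parts\<close>

text \<open>The leading minor of the diagonalized \<open>B\<close> is a weighted Gram determinant of
  the first \<open>k\<close> columns of \<open>T\<close>, seen in an eigenbasis of \<open>B\<close>.
  The factor \<open>g\<close> depends on \<open>T\<close> and \<open>k\<close> but not on
  \<open>B\<close>, so bounds for several matrices diagonalized by one \<open>T\<close> share
  it.\<close>

lemma leading_minor_bounds:
  assumes B: "hermitian_pos_def n B" and X: "X \<in> carrier_mat n n"
    and T: "T \<in> carrier_mat n n" "mat_adjoint T * X * T = 1\<^sub>m n"
    and w: "mat_adjoint T * B * T = mat_diag n (\<lambda>i. complex_of_real (w i))"
    and k: "k \<le> n"
  defines "g \<equiv> Re (det (weighted_gram n (T * mat n k (\<lambda>(i, j). if i = j then 1 else 0)) (\<lambda>_. 1)))"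
  shows "(\<Prod>i<k. w i) \<le> (\<Prod>i<k. eigs_dec B ! i) * g"
    and "(\<Prod>i<k. eigs_inc B ! i) * g \<le> (\<Prod>i<k. w i)"
    and "0 < g"
proof -
  note cB = hermitian_pos_defD[OF B]
  define J where "J = (mat n k (\<lambda>(i, j). if i = j then 1 else 0) :: complex mat)"
  have J: "J \<in> carrier_mat n k" by (simp add: J_def)
  define Tk where "Tk = T * J"
  have Tk: "Tk \<in> carrier_mat n k" "mat_adjoint Tk \<in> carrier_mat k n" using T J by (auto simp: Tk_def)
  \<comment> \<open>\<open>J\<close> consists of the first \<open>k\<close> columns of the identity,
    so congruence by \<open>J\<close> cuts out the leading block.\<close>
  have Jw: "weighted_gram n J v = mat_diag k (\<lambda>i. complex_of_real (v i))" for v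
  proof (rule eq_matI)
    fix l m assume "l < dim_row (mat_diag k (\<lambda>i. complex_of_real (v i)))"
      "m < dim_col (mat_diag k (\<lambda>i. complex_of_real (v i)))"
    then have lm: "l < k" "m < k" by (auto simp: mat_diag_def)
    have "weighted_gram n J v $$ (l, m) = (\<Sum>i<n. if i = l then of_real (v i) * (if i = m then 1 else 0) else 0)"
      unfolding weighted_gram_index[OF J lm] using lm by (intro sum.cong) (auto simp: J_def)
    also have "\<dots> = mat_diag k (\<lambda>i. complex_of_real (v i)) $$ (l, m)"
      using lm k by simp
    finally show "weighted_gram n J v $$ (l, m) = mat_diag k (\<lambda>i. complex_of_real (v i)) $$ (l, m)" .
  qed (use weighted_gram_carrier[OF J, of v] in \<open>auto simp: mat_diag_def\<close>)
  have Bk: "mat_adjoint Tk * B * Tk = mat_diag k (\<lambda>i. complex_of_real (w i))"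
    unfolding Tk_def congruence_comp[OF cB(1) T(1) J] w by (rule Jw[unfolded weighted_gram_def])
  have Xk: "mat_adjoint Tk * X * Tk = 1\<^sub>m k"
    unfolding Tk_def congruence_comp[OF X T(1) J] T(2)
    using Jw[of "\<lambda>_. 1"] by (simp add: weighted_gram_def)
  \<comment> \<open>The witnesses are \<open>S = V * Tk\<close> and the left inverse
    \<open>L\<close> formed as adjoint of \<open>Tk\<close> times \<open>X\<close> times adjoint of
    \<open>V\<close>. The Gram determinant with unit weights is \<open>g\<close> for every
    \<open>es\<close>, because the unitary \<open>V\<close> drops out.\<close>
  have *: "\<exists>S L. S \<in> carrier_mat n k \<and> L \<in> carrier_mat k n \<and> L * S = 1\<^sub>m k \<and>
      Re (det (weighted_gram n S (\<lambda>i. es ! i))) = (\<Prod>i<k. w i) \<and> Re (det (weighted_gram n S (\<lambda>_. 1))) = g"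
    if es: "mset es = mset (eigs_inc B)" for es
  proof -
    obtain V where V: "unitary_mat n V" "B = weighted_gram n V (\<lambda>i. es ! i)"
      by (rule hermitian_eq_weighted_gram[OF cB es])
    have Vc: "V \<in> carrier_mat n n" "mat_adjoint V \<in> carrier_mat n n" using V by (auto simp: unitary_mat_def)
    have S: "V * Tk \<in> carrier_mat n k" using Vc Tk by simp
    have XV: "mat_adjoint Tk * X \<in> carrier_mat k n" using X Tk by (intro mult_carrier_mat) auto
    have L: "mat_adjoint Tk * X * mat_adjoint V \<in> carrier_mat k n"
      by (rule mult_carrier_mat[OF XV Vc(2)])
    have "mat_adjoint Tk * X * mat_adjoint V * (V * Tk) = mat_adjoint Tk * X * (mat_adjoint V * (V * Tk))"
      by (rule assoc_mult_mat[OF XV Vc(2) S])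
    also have "mat_adjoint V * (V * Tk) = mat_adjoint V * V * Tk"
      by (rule assoc_mult_mat[symmetric, OF Vc(2,1) Tk(1)])
    also have "\<dots> = Tk" using V Tk by (simp add: unitary_mat_def)
    finally have LS: "mat_adjoint Tk * X * mat_adjoint V * (V * Tk) = 1\<^sub>m k" using Xk by simp
    have "weighted_gram n (V * Tk) (\<lambda>i. es ! i) = mat_diag k (\<lambda>i. complex_of_real (w i))"
      using weighted_gram_mult[OF Vc(1) Tk(1)] V(2) Bk by simp
    then have d: "Re (det (weighted_gram n (V * Tk) (\<lambda>i. es ! i))) = (\<Prod>i<k. w i)"
      by (simp add: det_mat_diag flip: of_real_prod)
    have "weighted_gram n V (\<lambda>_. 1) = 1\<^sub>m n"
      using V Vc by (simp add: weighted_gram_def unitary_mat_def)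
    then have "weighted_gram n (V * Tk) (\<lambda>_. 1) = weighted_gram n Tk (\<lambda>_. 1)"
      using weighted_gram_mult[OF Vc(1) Tk(1), of "\<lambda>_. 1"] by (simp add: weighted_gram_def)
    then have "Re (det (weighted_gram n (V * Tk) (\<lambda>_. 1))) = g"
      by (simp add: g_def Tk_def J_def)
    then show ?thesis using S L LS d by blast
  qed
  obtain S L where "S \<in> carrier_mat n k" "L \<in> carrier_mat k n" "L * S = 1\<^sub>m k"
    "Re (det (weighted_gram n S (\<lambda>i. eigs_dec B ! i))) = (\<Prod>i<k. w i)" "Re (det (weighted_gram n S (\<lambda>_. 1))) = g"
    using *[of "eigs_dec B"] by (auto simp: eigs_dec_def)
  then show "(\<Prod>i<k. w i) \<le> (\<Prod>i<k. eigs_dec B ! i) * g"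
    using det_weighted_gram_le[of S n k L "\<lambda>i. eigs_dec B ! i"] k eigs_dec_pos[OF B] eigs_dec_antimono[OF cB]
    by auto
  obtain S L where SL: "S \<in> carrier_mat n k" "L \<in> carrier_mat k n" "L * S = 1\<^sub>m k"
    "Re (det (weighted_gram n S (\<lambda>i. eigs_inc B ! i))) = (\<Prod>i<k. w i)" "Re (det (weighted_gram n S (\<lambda>_. 1))) = g"
    using *[OF refl] by auto
  then show "(\<Prod>i<k. eigs_inc B ! i) * g \<le> (\<Prod>i<k. w i)"
    using det_weighted_gram_ge[of S n k L "\<lambda>i. eigs_inc B ! i"] k eigs_inc_pos[OF B] eigs_inc_mono[OF cB]
    by auto
  have "hermitian_pos_def k (weighted_gram n S (\<lambda>_. 1))"
    by (rule hermitian_pos_def_weighted_gram[OF SL(1-3)]) simp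
  then show "0 < g" using hermitian_pos_def_det(1) SL(5) by metis
qed

lemma prod_eigs_inc_eq_dec:
  assumes "A \<in> carrier_mat n n" "mat_adjoint A = A"
  shows "(\<Prod>i<n. eigs_inc A ! i) = (\<Prod>i<n. eigs_dec A ! i)"
proof -
  have "complex_of_real (\<Prod>i<n. eigs_inc A ! i) = complex_of_real (\<Prod>i<n. eigs_dec A ! i)"
    using hermitian_det_eq_prod[OF assms, of "eigs_inc A"] hermitian_det_eq_prod[OF assms, of "eigs_dec A"]
    by (simp add: eigs_dec_def del: of_real_prod)
  then show ?thesis by (simp only: of_real_eq_iff)
qed

theorem det_add_le_prod_eigs_inc_dec:
  assumes A: "hermitian_pos_def n A" and B: "hermitian_pos_def n B"
  shows "Re (det (A + B)) \<le> (\<Prod>i<n. eigs_inc A ! i + eigs_dec B ! i)"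
proof -
  define C where "C = A + B"
  define a b where "a = (\<lambda>i. eigs_inc A ! i)" and "b = (\<lambda>i. eigs_dec B ! i)"
  have C: "hermitian_pos_def n C" unfolding C_def by (rule hermitian_pos_def_add[OF A B])
  note cA = hermitian_pos_defD[OF A] and cB = hermitian_pos_defD[OF B] and cC = hermitian_pos_defD[OF C]
  have pos: "0 < a i" "0 < b i" if "i < n" for i
    using eigs_inc_pos[OF A that] eigs_dec_pos[OF B that] by (simp_all add: a_def b_def)
  obtain T w where T: "T \<in> carrier_mat n n" "mat_adjoint T * C * T = 1\<^sub>m n"
    and wB: "mat_adjoint T * B * T = mat_diag n (\<lambda>i. complex_of_real (w i))"
    and wmono: "\<And>i j. i \<le> j \<Longrightarrow> j < n \<Longrightarrow> w j \<le> w i"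
    by (rule simultaneous_congruence_diag[OF C cB]) blast
  have T': "mat_adjoint T \<in> carrier_mat n n" using T by simp
  have split: "mat_adjoint T * C * T = mat_adjoint T * A * T + mat_adjoint T * B * T"
    unfolding C_def
    by (subst mult_add_distrib_mat[OF T' cA(1) cB(1)],
        rule add_mult_distrib_mat[of _ n n _ _ n]) (use cA cB T T' in auto)
  have TA: "mat_adjoint T * A * T \<in> carrier_mat n n" by (rule congruence_carrier[OF cA(1) T(1)])
  have wA: "mat_adjoint T * A * T = mat_diag n (\<lambda>i. complex_of_real (1 - w i))"
  proof (rule eq_matI)
    fix i j assume "i < dim_row (mat_diag n (\<lambda>i. complex_of_real (1 - w i)))"
      "j < dim_col (mat_diag n (\<lambda>i. complex_of_real (1 - w i)))"
    then have ij: "i < n" "j < n" by (auto simp: mat_diag_def)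
    have "(mat_adjoint T * A * T + mat_adjoint T * B * T) $$ (i, j) = (1\<^sub>m n :: complex mat) $$ (i, j)"
      using split T(2) by simp
    then have "(mat_adjoint T * A * T) $$ (i, j) + mat_diag n (\<lambda>i. complex_of_real (w i)) $$ (i, j)
        = (1\<^sub>m n :: complex mat) $$ (i, j)"
      unfolding wB using ij by (subst (asm) index_add_mat) (auto simp: mat_diag_def)
    then show "(mat_adjoint T * A * T) $$ (i, j) = mat_diag n (\<lambda>i. complex_of_real (1 - w i)) $$ (i, j)"
      using ij by (auto simp: algebra_simps split: if_splits simp del: index_mult_mat(1))
  qed (use TA in \<open>auto simp: mat_diag_def\<close>)
  \<comment> \<open>This product is a left inverse of \<open>T\<close>, so the transformed
    \<open>A\<close> and \<open>B\<close> stay positive definite and both \<open>w i\<close> and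
    \<open>1 - w i\<close> are positive.\<close>
  have TL: "mat_adjoint T * C \<in> carrier_mat n n" using T' cC by (intro mult_carrier_mat) auto
  have w01: "0 < w i" "w i < 1" if "i < n" for i
    using hermitian_pos_def_diag_pos[OF hermitian_pos_def_congruence[OF B T(1) TL T(2)] that]
      hermitian_pos_def_diag_pos[OF hermitian_pos_def_congruence[OF A T(1) TL T(2)] that] that
    unfolding wA wB by simp_all
  define g where "g = (\<lambda>k. Re (det (weighted_gram n (T * mat n k (\<lambda>(i, j). if i = j then 1 else 0)) (\<lambda>_. 1))))"
  have gB: "(\<Prod>i<k. w i) \<le> (\<Prod>i<k. b i) * g k" "0 < g k" if "k \<le> n" for k
    unfolding g_def b_def using leading_minor_bounds[OF B cC(1) T wB that] by blast+
  have gA: "(\<Prod>i<k. a i) * g k \<le> (\<Prod>i<k. 1 - w i)" if "k \<le> n" for k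
    unfolding g_def a_def by (rule leading_minor_bounds(2)[OF A cC(1) T wA that])
  \<comment> \<open>For \<open>k = n\<close> the upper and the lower minor bound coincide, since the
    product of all eigenvalues does not depend on their order.\<close>
  have gBn: "(\<Prod>i<n. b i) * g n = (\<Prod>i<n. w i)"
    using gB(1)[of n] leading_minor_bounds(2)[OF B cC(1) T wB order_refl] prod_eigs_inc_eq_dec[OF cB]
    by (simp add: g_def b_def)
  have gAn: "(\<Prod>i<n. a i) * g n = (\<Prod>i<n. 1 - w i)"
    using gA[of n] leading_minor_bounds(1)[OF A cC(1) T wA order_refl] prod_eigs_inc_eq_dec[OF cA]
    by (simp add: g_def a_def)
  \<comment> \<open>The identity is written as a diagonal matrix so that the minor bounds apply to
    \<open>C\<close> itself; for \<open>k = n\<close> they force \<open>det C\<close> and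
    \<open>g n\<close> to be reciprocal.\<close>
  have T2: "mat_adjoint T * C * T = mat_diag n (\<lambda>i. complex_of_real 1)" using T(2) by simp
  have gC: "Re (det C) * g n = 1"
  proof -
    have "Re (det C) = (\<Prod>i<n. eigs_inc C ! i)"
      using hermitian_det_eq_prod[OF cC refl] by (simp del: of_real_prod)
    moreover have "(\<Prod>i<n. eigs_inc C ! i) = (\<Prod>i<n. eigs_dec C ! i)"
      by (rule prod_eigs_inc_eq_dec[OF cC])
    ultimately show ?thesis
      using leading_minor_bounds(1,2)[OF C cC(1) T T2 order_refl] by (simp add: g_def)
  qed
  have g0: "g 0 = 1"
    unfolding g_def using T(1)
    by (subst det_dim_zero[OF weighted_gram_carrier[of _ n]]) (auto intro!: mult_carrier_mat)
  \<comment> \<open>The increments of \<open>ln g\<close> distribute \<open>ln (g n)\<close> over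
    the indices; the telescoping starts at \<open>ln (g 0) = 0\<close>, from the empty
    determinant.\<close>
  define \<gamma> where "\<gamma> = (\<lambda>i. ln (g (Suc i)) - ln (g i))"
  have sum\<gamma>: "(\<Sum>i<k. \<gamma> i) = ln (g k)" for k
    by (induction k) (simp_all add: \<gamma>_def g0)
  have lnb: "(\<Sum>i<k. ln (b i)) = ln (\<Prod>i<k. b i)" and lna: "(\<Sum>i<k. ln (a i)) = ln (\<Prod>i<k. a i)"
    and lnw: "(\<Sum>i<k. ln (w i)) = ln (\<Prod>i<k. w i)" and lnw': "(\<Sum>i<k. ln (1 - w i)) = ln (\<Prod>i<k. 1 - w i)"
    and pp: "0 < (\<Prod>i<k. b i)" "0 < (\<Prod>i<k. a i)" "0 < (\<Prod>i<k. w i)" "0 < (\<Prod>i<k. 1 - w i)"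
    if "k \<le> n" for k
    using that pos w01 by (auto intro!: ln_prod_lessThan[symmetric] prod_pos)
  \<comment> \<open>The partial sums are logarithms of the ratios of the two sides of
    \<open>gB\<close>: nonnegative for every \<open>k\<close>, zero for \<open>k = n\<close>. The
    weights \<open>w\<close> decrease.\<close>
  have y: "0 \<le> (\<Sum>i<n. w i * (ln (b i) - ln (w i) + \<gamma> i))"
  proof (rule sum_antimono_weights_nonneg[OF wmono])
    have eq: "(\<Sum>i<k. ln (b i) - ln (w i) + \<gamma> i) = ln ((\<Prod>i<k. b i) * g k) - ln (\<Prod>i<k. w i)" if "k \<le> n" for k
      by (simp add: sum.distrib sum_subtractf lnb[OF that] lnw[OF that] sum\<gamma>
          ln_mult_pos[OF pp(1) gB(2), OF that that])
    show "0 \<le> (\<Sum>i<k. ln (b i) - ln (w i) + \<gamma> i)" if "k \<le> n" for k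
      unfolding eq[OF that] using gB[OF that] pp[OF that] by simp
    show "(\<Sum>i<n. ln (b i) - ln (w i) + \<gamma> i) = 0" unfolding eq[OF order_refl] gBn by simp
  qed
  \<comment> \<open>Here the partial sums come from \<open>gA\<close> in the same way, but the
    weights \<open>1 - w\<close> increase, so the sign of the result is reversed.\<close>
  have x: "(\<Sum>i<n. (1 - w i) * (ln (1 - w i) - ln (a i) - \<gamma> i)) \<le> 0"
  proof (rule sum_mono_weights_nonpos)
    have eq: "(\<Sum>i<k. ln (1 - w i) - ln (a i) - \<gamma> i) = ln (\<Prod>i<k. 1 - w i) - ln ((\<Prod>i<k. a i) * g k)" if "k \<le> n" for k
      by (simp add: sum_subtractf lna[OF that] lnw'[OF that] sum\<gamma>
          ln_mult_pos[OF pp(2) gB(2), OF that that])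
    show "0 \<le> (\<Sum>i<k. ln (1 - w i) - ln (a i) - \<gamma> i)" if "k \<le> n" for k
      unfolding eq[OF that] using gA[OF that] gB(2)[OF that] pp[OF that] by simp
    show "(\<Sum>i<n. ln (1 - w i) - ln (a i) - \<gamma> i) = 0" unfolding eq[OF order_refl] gAn by simp
  qed (use wmono in simp)
  have "- (\<Sum>i<n. \<gamma> i) \<le> (\<Sum>i<n. w i * (ln (b i) - ln (w i) + \<gamma> i))
      - (\<Sum>i<n. (1 - w i) * (ln (1 - w i) - ln (a i) - \<gamma> i)) - (\<Sum>i<n. \<gamma> i)"
    using x y by simp
  \<comment> \<open>The coefficients \<open>w i\<close> and \<open>1 - w i\<close> of
    \<open>\<gamma> i\<close> add up to 1, so all \<open>\<gamma>\<close> terms cancel and each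
    summand is the left side of the concavity bound.\<close>
  also have "\<dots> = (\<Sum>i<n. w i * (ln (b i) - ln (w i)) + (1 - w i) * (ln (a i) - ln (1 - w i)))"
    unfolding sum_subtractf[symmetric] by (intro sum.cong refl) (simp add: algebra_simps)
  also have "\<dots> \<le> (\<Sum>i<n. ln (a i + b i))"
    using pos w01 by (intro sum_mono ln_add_ge_weighted) auto
  also have "\<dots> = ln (\<Prod>i<n. a i + b i)"
    using pos by (intro ln_prod_lessThan[symmetric] add_pos_pos)
  finally have "- ln (g n) \<le> ln (\<Prod>i<n. a i + b i)" by (simp add: sum\<gamma>)
  moreover have "Re (det C) = 1 / g n" using gC gB(2)[of n] by (simp add: field_simps)
  ultimately have "ln (Re (det C)) \<le> ln (\<Prod>i<n. a i + b i)"
    using gB(2)[of n] by (simp add: ln_div)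
  then have "Re (det C) \<le> (\<Prod>i<n. a i + b i)"
    using hermitian_pos_def_det(1)[OF C] pos
    by (subst (asm) ln_le_cancel_iff) (auto intro!: prod_pos add_pos_pos)
  then show ?thesis by (simp add: C_def a_def b_def)
qed

section \<open>From determinants to \<open>delta_S\<close>\<close>

text \<open>When the individual determinants agree, the second logarithm is the same on both sides.
  The halving contributes the common factor \<open>(1 / 2) ^ n\<close>, and \<open>ln\<close> and
  \<open>sqrt\<close> are monotone.\<close>

lemma delta_S_mono:
  assumes X: "X \<in> carrier_mat n n" "X' \<in> carrier_mat n n" and Y: "Y \<in> carrier_mat n n" "Y' \<in> carrier_mat n n"
    and det: "det X = det X'" "det Y = det Y'"
    and pos: "0 < Re (det (X + Y))" and le: "Re (det (X + Y)) \<le> Re (det (X' + Y'))"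
  shows "delta_S X Y \<le> delta_S X' Y'"
proof -
  have half: "Re (det ((1 / 2) \<cdot>\<^sub>m M)) = (1 / 2) ^ n * Re (det M)" if "M \<in> carrier_mat n n" for M :: "complex mat"
  proof -
    have "det ((1 / 2) \<cdot>\<^sub>m M) = of_real ((1 / 2) ^ n) * det M" using that by simp
    then show ?thesis by (simp only: times_complex.sel Re_complex_of_real Im_complex_of_real mult_zero_left diff_zero)
  qed
  have "ln (Re (det ((1 / 2) \<cdot>\<^sub>m (X + Y)))) \<le> ln (Re (det ((1 / 2) \<cdot>\<^sub>m (X' + Y'))))"
    using X Y pos le by (subst ln_le_cancel_iff) (auto simp: half)
  moreover have "det (X * Y) = det (X' * Y')"
    using X Y det by (simp add: det_mult[of _ n])
  ultimately show ?thesis by (simp add: delta_S_def delta_S_sq_def)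
qed

theorem corollary3p8:
  fixes n :: nat and A B :: "complex mat"
  assumes "hermitian_pos_def n A" and "hermitian_pos_def n B"
  shows "delta_S (Eig_down A) (Eig_down B) \<le> delta_S A B \<and>
         delta_S A B \<le> delta_S (Eig_down A) (Eig_up B)"
proof -
  note cA = hermitian_pos_defD[OF assms(1)] and cB = hermitian_pos_defD[OF assms(2)]
  have down: "Eig_down X = mat_diag n (\<lambda>i. complex_of_real (eigs_dec X ! i))"
    and up: "Eig_up X = mat_diag n (\<lambda>i. complex_of_real (eigs_inc X ! i))"
    and det: "det (Eig_down X) = det X" "det (Eig_up X) = det X"
    if "X \<in> carrier_mat n n" "mat_adjoint X = X" for X
    using that hermitian_det_eq_prod[OF that, of "eigs_inc X"] hermitian_det_eq_prod[OF that, of "eigs_dec X"]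
    by (simp_all add: Eig_down_def Eig_up_def det_mat_diag eigs_dec_def)
  have car: "Eig_down X \<in> carrier_mat n n" "Eig_up X \<in> carrier_mat n n"
    if "X \<in> carrier_mat n n" "mat_adjoint X = X" for X
    using that by (simp_all add: down up)
  have dd: "Re (det (Eig_down A + Eig_down B)) = (\<Prod>i<n. eigs_dec A ! i + eigs_dec B ! i)"
    by (simp add: down[OF cA] down[OF cB] mat_diag_add det_mat_diag flip: of_real_add of_real_prod)
  have du: "Re (det (Eig_down A + Eig_up B)) = (\<Prod>i<n. eigs_dec A ! i + eigs_inc B ! i)"
    by (simp add: down[OF cA] up[OF cB] mat_diag_add det_mat_diag flip: of_real_add of_real_prod)
  have "delta_S (Eig_down A) (Eig_down B) \<le> delta_S A B"
  proof (rule delta_S_mono[of _ n])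
    show "0 < Re (det (Eig_down A + Eig_down B))"
      unfolding dd using eigs_dec_pos[OF assms(1)] eigs_dec_pos[OF assms(2)]
      by (intro prod_pos) (auto intro: add_pos_pos)
    show "Re (det (Eig_down A + Eig_down B)) \<le> Re (det (A + B))"
      unfolding dd by (rule prod_eigs_dec_le_det_add[OF assms])
  qed (use car cA cB det in auto)
  moreover have "delta_S A B \<le> delta_S (Eig_down A) (Eig_up B)"
  proof (rule delta_S_mono[of _ n])
    show "0 < Re (det (A + B))"
      by (rule hermitian_pos_def_det(1)[OF hermitian_pos_def_add[OF assms]])
    show "Re (det (A + B)) \<le> Re (det (Eig_down A + Eig_up B))"
      \<comment> \<open>The bound takes the increasing spectrum from its first matrix, hence the
        exchange of \<open>A\<close> and \<open>B\<close>.\<close>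
      using det_add_le_prod_eigs_inc_dec[OF assms(2,1)] comm_add_mat[OF cB(1) cA(1)]
      unfolding du by (simp add: add.commute)
  qed (use car cA cB det in auto)
  ultimately show ?thesis by blast
qed

end
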